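(* Let $R$ be a commutative Noetherian ring of characteristic $p>0$ of one of the following two types: (A) a complete local Noetherian ring with residue field $k$ satisfying $[k:k^p]<\infty$ (containing a field of characteristic $p$); or (B) an $\mathbb{N}$-graded ring $R=k\oplus R_1\oplus R_2\oplus\cdots$, finitely generated over a field $k$ of characteristic $p$ with $[k:k^p]<\infty$. If $R$ is strongly F-regular and has finite F-representation type, then the ring of differential operators $D(R)=D_{\mathbb{Z}}(R)$ is a simple ring.
   Context: Differential operators: for a commutative ring $k_0$ and a commutative $k_0$-algebra $R$, $D_{k_0}(R)=\bigcup_{n\ge 0}D^n_{k_0}(R)$, where $D^0_{k_0}(R)=\operatorname{Hom}_R(R,R)$ and $D^n_{k_0}(R)=\{\theta\in\operatorname{Hom}_{k_0}(R,R)\mid r\circ\theta-\theta\circ r\in D^{n-1}_{k_0}(R)\ \forall r\in R\}$; $D(R)$ means $D_{\mathbb{Z}}(R)$. Frobenius: for an $R$-module $M$ and $e\ge 0$, ${}^eM$ is the abelian group $M$ with $R$-action $r\cdot m=r^{p^e}m$. In the graded case, if $M$ is $\mathbb{Q}$-graded, ${}^eM$ is $\mathbb{Q}$-graded by $({}^eM)_\alpha=M_{p^e\alpha}$. Finite F-representation type (FFRT): let $M(R)$ be the category of finitely generated $R$-modules in case (A), and of finitely generated $\mathbb{Q}$-graded $R$-modules (with degree-preserving maps) in case (B). The Krull–Schmidt theorem holds in $M(R)$. Write $[M]$ for the isomorphism class of $M$, where in case (B) $[M]=[N]$ means $N\cong M(\alpha)$ by a degree-preserving isomorphism for some $\alpha\in\mathbb{Q}$,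 with $M(\alpha)_i=M_{i+\alpha}$. Decompose ${}^eR=M_1^{(e)}\oplus\cdots\oplus M_{n_e}^{(e)}$ into indecomposables in $M(R)$. $R$ has FFRT if the set $\{[M_i^{(e)}]\mid e\in\mathbb{N},\ 1\le i\le n_e\}$ is finite. Strong F-regularity: a reduced ring $R$ of characteristic $p$ that is finitely generated as a module over $R^p$ is strongly F-regular if for every $c\in R$ not in any minimal prime there is $q=p^e$ such that the $R$-module map $R\to R^{1/q}$ sending $1\mapsto c^{1/q}$ splits. *)

theory Defs
  imports "HOL-Algebra.Algebra"
begin

section \<open>Modules, homomorphisms and direct sums\<close>

(* The additive group of R with a new scalar action; the ring structure is kept in the record. *)
definition with_action ::
    "('a, 'b) ring_scheme \<Rightarrow> ('c \<Rightarrow> 'a \<Rightarrow> 'a) \<Rightarrow> ('c, 'a) module"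
  where "with_action R act =
    \<lparr>carrier = carrier R, monoid.mult = (\<otimes>\<^bsub>R\<^esub>), one = \<one>\<^bsub>R\<^esub>, ring.zero = \<zero>\<^bsub>R\<^esub>, add = (\<oplus>\<^bsub>R\<^esub>), smult = act\<rparr>"

definition regular_module :: "('a, 'b) ring_scheme \<Rightarrow> ('a, 'a) module"
  where "regular_module R = with_action R (\<lambda>r x. r \<otimes>\<^bsub>R\<^esub> x)"

definition int_algebra :: "('a, 'b) ring_scheme \<Rightarrow> (int, 'a) module"
  where "int_algebra R = with_action R (\<lambda>n x. [n] \<cdot>\<^bsub>R\<^esub> x)"

definition frobenius_module :: "nat \<Rightarrow> nat \<Rightarrow> ('a, 'b) ring_scheme \<Rightarrow> ('a, 'a) module"
  where "frobenius_module p e R = with_action R (\<lambda>r x. (r [^]\<^bsub>R\<^esub> (p ^ e)) \<otimes>\<^bsub>R\<^esub> x)"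

(* Maps are extensional, so that equality in mod_hom is equality of maps on the carrier. *)
definition mod_hom ::
    "('c, 'd) ring_scheme \<Rightarrow> ('c, 'a, 'e) module_scheme \<Rightarrow> ('c, 'b, 'f) module_scheme
      \<Rightarrow> ('a \<Rightarrow> 'b) set"
  where "mod_hom K M N = {f \<in> carrier M \<rightarrow>\<^sub>E carrier N.
    (\<forall>x \<in> carrier M. \<forall>y \<in> carrier M. f (x \<oplus>\<^bsub>M\<^esub> y) = f x \<oplus>\<^bsub>N\<^esub> f y) \<and>
    (\<forall>a \<in> carrier K. \<forall>x \<in> carrier M. f (a \<odot>\<^bsub>M\<^esub> x) = a \<odot>\<^bsub>N\<^esub> f x)}"

definition mod_iso ::
    "('c, 'd) ring_scheme \<Rightarrow> ('c, 'a, 'e) module_scheme \<Rightarrow> ('c, 'b, 'f) module_scheme \<Rightarrow> bool"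
  where "mod_iso K M N \<longleftrightarrow> (\<exists>f \<in> mod_hom K M N. bij_betw f (carrier M) (carrier N))"

definition splits ::
    "('c, 'd) ring_scheme \<Rightarrow> ('c, 'a, 'e) module_scheme \<Rightarrow> ('c, 'b, 'f) module_scheme
      \<Rightarrow> ('a \<Rightarrow> 'b) \<Rightarrow> bool"
  where "splits K M N f \<longleftrightarrow> (\<exists>g \<in> mod_hom K N M. \<forall>x \<in> carrier M. g (f x) = x)"

definition fg_module :: "('c, 'd) ring_scheme \<Rightarrow> ('c, 'a, 'e) module_scheme \<Rightarrow> bool"
  where "fg_module K M \<longleftrightarrow> (\<exists>S. finite S \<and> S \<subseteq> carrier M \<and>
    (\<forall>x \<in> carrier M. \<exists>a \<in> S \<rightarrow> carrier K. x = (\<Oplus>\<^bsub>M\<^esub> s \<in> S. a s \<odot>\<^bsub>M\<^esub> s)))"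

definition internal_direct_sum ::
    "('a, 'b) ring_scheme \<Rightarrow> 'i set \<Rightarrow> ('i \<Rightarrow> 'a set) \<Rightarrow> bool"
  where "internal_direct_sum M I N \<longleftrightarrow>
    (\<forall>i \<in> I. additive_subgroup (N i) M) \<and>
    (\<forall>x \<in> carrier M. \<exists>!f. f \<in> (\<Pi>\<^sub>E i \<in> I. N i) \<and> finite {i \<in> I. f i \<noteq> \<zero>\<^bsub>M\<^esub>} \<and>
       x = (\<Oplus>\<^bsub>M\<^esub> i \<in> {i \<in> I. f i \<noteq> \<zero>\<^bsub>M\<^esub>}. f i))"


section \<open>Rings\<close>

definition has_char :: "('a, 'b) ring_scheme \<Rightarrow> nat \<Rightarrow> bool"
  where "has_char R p \<longleftrightarrow> (\<forall>n :: nat. [n] \<cdot>\<^bsub>R\<^esub> \<one>\<^bsub>R\<^esub> = \<zero>\<^bsub>R\<^esub> \<longleftrightarrow> p dvd n)"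

definition simple_ring :: "('a, 'b) ring_scheme \<Rightarrow> bool"
  where "simple_ring S \<longleftrightarrow> ring S \<and> \<one>\<^bsub>S\<^esub> \<noteq> \<zero>\<^bsub>S\<^esub> \<and>
    (\<forall>I. ideal I S \<longrightarrow> I = {\<zero>\<^bsub>S\<^esub>} \<or> I = carrier S)"

definition reduced_ring :: "('a, 'b) ring_scheme \<Rightarrow> bool"
  where "reduced_ring R \<longleftrightarrow>
    (\<forall>x \<in> carrier R. \<forall>n :: nat. x [^]\<^bsub>R\<^esub> n = \<zero>\<^bsub>R\<^esub> \<longrightarrow> x = \<zero>\<^bsub>R\<^esub>)"

definition minimal_prime :: "'a set \<Rightarrow> ('a, 'b) ring_scheme \<Rightarrow> bool"
  where "minimal_prime P R \<longleftrightarrow> primeideal P R \<and> (\<forall>Q. primeideal Q R \<and> Q \<subseteq> P \<longrightarrow> Q = P)"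

definition pth_powers :: "nat \<Rightarrow> ('a, 'b) ring_scheme \<Rightarrow> 'a set \<Rightarrow> 'a set"
  where "pth_powers p R A = {x [^]\<^bsub>R\<^esub> p | x. x \<in> A}"

(* For reduced R, the R-module R^(1/q), q = p^e, is identified with frobenius_module p e R by
   sending x^(1/q) to x.  The map R \<rightarrow> R^(1/q) with 1 \<mapsto> c^(1/q) becomes r \<mapsto> r \<odot> c = r^q c. *)
definition strongly_F_regular :: "nat \<Rightarrow> ('a, 'b) ring_scheme \<Rightarrow> bool"
  where "strongly_F_regular p R \<longleftrightarrow>
    cring R \<and> has_char R p \<and> reduced_ring R \<and>
    fg_module (R\<lparr>carrier := pth_powers p R (carrier R)\<rparr>) (regular_module R) \<and>
    (\<forall>c \<in> carrier R. (\<forall>P. minimal_prime P R \<longrightarrow> c \<notin> P) \<longrightarrow>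
       (\<exists>e. splits R (regular_module R) (frobenius_module p e R)
              (\<lambda>r \<in> carrier R. r \<odot>\<^bsub>frobenius_module p e R\<^esub> c)))"

definition unique_maximal_ideal :: "'a set \<Rightarrow> ('a, 'b) ring_scheme \<Rightarrow> bool"
  where "unique_maximal_ideal m R \<longleftrightarrow> maximalideal m R \<and> (\<forall>m'. maximalideal m' R \<longrightarrow> m' = m)"

(* R \<rightarrow> lim R/m^n is bijective: existence of y is surjectivity, uniqueness is injectivity. *)
definition adically_complete :: "('a, 'b) ring_scheme \<Rightarrow> 'a set \<Rightarrow> bool"
  where "adically_complete R m \<longleftrightarrow> (\<forall>x :: nat \<Rightarrow> 'a.
    (\<forall>n. x n \<in> carrier R) \<and> (\<forall>n. x (Suc n) \<ominus>\<^bsub>R\<^esub> x n \<in> m [^]\<^bsub>ideals_set R\<^esub> n) \<longrightarrow>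
    (\<exists>!y. y \<in> carrier R \<and> (\<forall>n. y \<ominus>\<^bsub>R\<^esub> x n \<in> m [^]\<^bsub>ideals_set R\<^esub> n)))"

definition complete_local_type :: "nat \<Rightarrow> ('a, 'b) ring_scheme \<Rightarrow> bool"
  where "complete_local_type p R \<longleftrightarrow> (\<exists>K. subfield K R) \<and>
    (\<exists>m. unique_maximal_ideal m R \<and> adically_complete R m \<and>
       ring.finite_dimension (R Quot m)
         (pth_powers p (R Quot m) (carrier (R Quot m))) (carrier (R Quot m)))"

definition graded_ring :: "('a, 'b) ring_scheme \<Rightarrow> (nat \<Rightarrow> 'a set) \<Rightarrow> bool"
  where "graded_ring R G \<longleftrightarrow> internal_direct_sum R UNIV G \<and>
    (\<forall>i j. \<forall>x \<in> G i. \<forall>y \<in> G j. x \<otimes>\<^bsub>R\<^esub> y \<in> G (i + j))"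

definition graded_type :: "nat \<Rightarrow> ('a, 'b) ring_scheme \<Rightarrow> (nat \<Rightarrow> 'a set) \<Rightarrow> bool"
  where "graded_type p R G \<longleftrightarrow> graded_ring R G \<and> subfield (G 0) R \<and>
    (\<exists>S. finite S \<and> S \<subseteq> carrier R \<and> generate_ring R (G 0 \<union> S) = carrier R) \<and>
    ring.finite_dimension R (pth_powers p R (G 0)) (G 0)"


section \<open>Finite F-representation type\<close>

definition indecomposable_module :: "('c, 'd) ring_scheme \<Rightarrow> ('c, 'a, 'e) module_scheme \<Rightarrow> bool"
  where "indecomposable_module K M \<longleftrightarrow>
    module K M \<and> fg_module K M \<and> carrier M \<noteq> {\<zero>\<^bsub>M\<^esub>} \<and>
    (\<forall>N N'. submodule N K M \<and> submodule N' K M \<and>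
       N \<inter> N' = {\<zero>\<^bsub>M\<^esub>} \<and> N <+>\<^bsub>M\<^esub> N' = carrier M \<longrightarrow> N = {\<zero>\<^bsub>M\<^esub>} \<or> N' = {\<zero>\<^bsub>M\<^esub>})"

definition iso_class :: "('c, 'd) ring_scheme \<Rightarrow> ('c, 'a) module \<Rightarrow> ('c, 'a) module set"
  where "iso_class K M = {N. module K N \<and> fg_module K N \<and> mod_iso K N M}"

(* By Krull-Schmidt the iso classes occurring do not depend on the chosen decompositions. *)
definition FFRT :: "nat \<Rightarrow> ('a, 'b) ring_scheme \<Rightarrow> bool"
  where "FFRT p R \<longleftrightarrow> (\<exists>(n :: nat \<Rightarrow> nat) (M :: nat \<Rightarrow> nat \<Rightarrow> 'a set).
    (\<forall>e. internal_direct_sum (frobenius_module p e R) {..<n e} (M e) \<and>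
       (\<forall>i < n e. submodule (M e i) R (frobenius_module p e R) \<and>
          indecomposable_module R ((frobenius_module p e R)\<lparr>carrier := M e i\<rparr>))) \<and>
    finite {iso_class R ((frobenius_module p e R)\<lparr>carrier := M e i\<rparr>) | e i. i < n e})"

record ('a, 'b) qgraded_module = "('a, 'b) module" +
  homog :: "rat \<Rightarrow> 'b set"

definition qgraded :: "('a, 'b) ring_scheme \<Rightarrow> (nat \<Rightarrow> 'a set) \<Rightarrow> ('a, 'c) qgraded_module \<Rightarrow> bool"
  where "qgraded R G M \<longleftrightarrow> module R M \<and> internal_direct_sum M UNIV (homog M) \<and>
    (\<forall>i \<alpha>. \<forall>r \<in> G i. \<forall>x \<in> homog M \<alpha>. r \<odot>\<^bsub>M\<^esub> x \<in> homog M (of_nat i + \<alpha>))"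

definition qshift :: "rat \<Rightarrow> ('a, 'c) qgraded_module \<Rightarrow> ('a, 'c) qgraded_module"
  where "qshift \<alpha> M = M\<lparr>homog := \<lambda>i. homog M (i + \<alpha>)\<rparr>"

definition graded_iso ::
    "('a, 'b) ring_scheme \<Rightarrow> ('a, 'c) qgraded_module \<Rightarrow> ('a, 'd) qgraded_module \<Rightarrow> bool"
  where "graded_iso R M N \<longleftrightarrow> (\<exists>f \<in> mod_hom R M N. bij_betw f (carrier M) (carrier N) \<and>
    (\<forall>\<alpha>. f ` homog M \<alpha> \<subseteq> homog N \<alpha>))"

definition qrestrict :: "('a, 'c) qgraded_module \<Rightarrow> 'c set \<Rightarrow> ('a, 'c) qgraded_module"
  where "qrestrict M N = M\<lparr>carrier := N, homog := \<lambda>\<alpha>. homog M \<alpha> \<inter> N\<rparr>"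

definition graded_submodule ::
    "'c set \<Rightarrow> ('a, 'b) ring_scheme \<Rightarrow> (nat \<Rightarrow> 'a set) \<Rightarrow> ('a, 'c) qgraded_module \<Rightarrow> bool"
  where "graded_submodule N R G M \<longleftrightarrow> submodule N R M \<and> qgraded R G (qrestrict M N)"

definition graded_indecomposable ::
    "('a, 'b) ring_scheme \<Rightarrow> (nat \<Rightarrow> 'a set) \<Rightarrow> ('a, 'c) qgraded_module \<Rightarrow> bool"
  where "graded_indecomposable R G M \<longleftrightarrow>
    qgraded R G M \<and> fg_module R M \<and> carrier M \<noteq> {\<zero>\<^bsub>M\<^esub>} \<and>
    (\<forall>N N'. graded_submodule N R G M \<and> graded_submodule N' R G M \<and>
       N \<inter> N' = {\<zero>\<^bsub>M\<^esub>} \<and> N <+>\<^bsub>M\<^esub> N' = carrier M \<longrightarrow> N = {\<zero>\<^bsub>M\<^esub>} \<or> N' = {\<zero>\<^bsub>M\<^esub>})"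

definition graded_iso_class ::
    "('a, 'b) ring_scheme \<Rightarrow> (nat \<Rightarrow> 'a set) \<Rightarrow> ('a, 'c) qgraded_module
      \<Rightarrow> ('a, 'c) qgraded_module set"
  where "graded_iso_class R G M =
    {N. qgraded R G N \<and> fg_module R N \<and> (\<exists>\<alpha>. graded_iso R N (qshift \<alpha> M))}"

(* The natural-number grading G of R, regarded as a rational grading. *)
definition rat_grading :: "('a, 'b) ring_scheme \<Rightarrow> (nat \<Rightarrow> 'a set) \<Rightarrow> rat \<Rightarrow> 'a set"
  where "rat_grading R G \<beta> = (if \<beta> \<in> \<nat> then G (nat \<lfloor>\<beta>\<rfloor>) else {\<zero>\<^bsub>R\<^esub>})"

definition graded_frobenius_module ::
    "nat \<Rightarrow> nat \<Rightarrow> ('a, 'b) ring_scheme \<Rightarrow> (nat \<Rightarrow> 'a set) \<Rightarrow> ('a, 'a) qgraded_module"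
  where "graded_frobenius_module p e R G =
    module.extend (frobenius_module p e R)
      (qgraded_module.fields (\<lambda>\<alpha>. rat_grading R G (of_nat (p ^ e) * \<alpha>)))"

definition graded_FFRT :: "nat \<Rightarrow> ('a, 'b) ring_scheme \<Rightarrow> (nat \<Rightarrow> 'a set) \<Rightarrow> bool"
  where "graded_FFRT p R G \<longleftrightarrow> (\<exists>(n :: nat \<Rightarrow> nat) (M :: nat \<Rightarrow> nat \<Rightarrow> 'a set).
    (\<forall>e. internal_direct_sum (graded_frobenius_module p e R G) {..<n e} (M e) \<and>
       (\<forall>i < n e. graded_submodule (M e i) R G (graded_frobenius_module p e R G) \<and>
          graded_indecomposable R G (qrestrict (graded_frobenius_module p e R G) (M e i)))) \<and>
    finite {graded_iso_class R G (qrestrict (graded_frobenius_module p e R G) (M e i)) | e i.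
      i < n e})"


section \<open>Differential operators\<close>

fun diff_ops_order :: "('c, 'd) ring_scheme \<Rightarrow> ('c, 'a) module \<Rightarrow> nat \<Rightarrow> ('a \<Rightarrow> 'a) set"
  where
    "diff_ops_order K A 0 = mod_hom A (regular_module A) (regular_module A)"
  | "diff_ops_order K A (Suc n) = {\<theta> \<in> mod_hom K A A. \<forall>r \<in> carrier A.
       (\<lambda>x \<in> carrier A. (r \<otimes>\<^bsub>A\<^esub> \<theta> x) \<ominus>\<^bsub>A\<^esub> \<theta> (r \<otimes>\<^bsub>A\<^esub> x)) \<in> diff_ops_order K A n}"

definition diff_ops :: "('c, 'd) ring_scheme \<Rightarrow> ('c, 'a) module \<Rightarrow> ('a \<Rightarrow> 'a) ring"
  where "diff_ops K A =
    \<lparr>carrier = (\<Union>n. diff_ops_order K A n),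
     monoid.mult = compose (carrier A),
     one = (\<lambda>x \<in> carrier A. x),
     ring.zero = (\<lambda>x \<in> carrier A. \<zero>\<^bsub>A\<^esub>),
     add = (\<lambda>\<theta> \<phi>. \<lambda>x \<in> carrier A. \<theta> x \<oplus>\<^bsub>A\<^esub> \<phi> x)\<rparr>"

definition diff_ops_int :: "('a, 'b) ring_scheme \<Rightarrow> ('a \<Rightarrow> 'a) ring"
  where "diff_ops_int R = diff_ops \<Z> (int_algebra R)"

end

theory Submission
  imports Defs
begin

text \<open>
  Write \<open>q = p ^ e\<close> and \<open>R\<^sup>q\<close> for the subring of \<open>q\<close>-th powers.  Since \<open>R\<close> is finite over \<open>R\<^sup>p\<close>, the ring
  \<open>D(R)\<close> is the increasing union of the endomorphism rings of \<open>R\<close> over \<open>R\<^sup>q\<close>, that is, of the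
  \<open>R\<close>-modules \<open>\<^sup>eR\<close> (\<open>carrier_diff_ops_int\<close>): an operator of order \<open>n\<close> is linear over
  \<open>p ^ n\<close>-th powers, and conversely the commutator with \<open>u\<close>, iterated \<open>q\<close> times, is the commutator with
  \<open>u ^ q\<close> and vanishes on \<open>R\<^sup>q\<close>-linear maps, which bounds their order because finitely many \<open>u\<close>
  generate \<open>R\<close> over \<open>R\<^sup>q\<close>.

  Local rings and connected graded rings have no nontrivial idempotents, and this forces a strongly
  F-regular ring to be a domain (\<open>strongly_F_regular_domain\<close>).  So every \<open>c \<noteq> 0\<close> is sent to 1 by some
  functional on some \<open>\<^sup>eR\<close>, and Frobenius splits: \<open>R\<close> is a direct summand of \<open>\<^sup>1R\<close>, and hence \<open>\<^sup>fR\<close> of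
  \<open>\<^bsup>f'\<^esup>R\<close> whenever \<open>f \<le> f'\<close>.

  Let \<open>I\<close> be a nonzero two-sided ideal of \<open>D(R)\<close>.  Strong F-regularity provides an operator in \<open>I\<close> that
  maps 1 to 1.  It fixes \<open>R\<^sup>q\<close> for large \<open>q = p ^ E\<close>, so composing it with a projection of \<open>R\<close> onto
  \<open>R\<^sup>q\<close> puts that projection into \<open>I\<close>.  Viewed as an endomorphism of \<open>\<^sup>NR\<close> with \<open>N = f + E\<close>, it projects onto a
  copy of \<open>\<^sup>fR\<close>, for every \<open>f\<close>.  Hence \<open>I\<close> contains all endomorphisms of \<open>\<^sup>NR\<close> that factor through
  \<open>\<^sup>fR\<close> (\<open>ideal_diff_ops_trivial\<close>).

  Finite F-representation type now says that for some \<open>f\<close> every indecomposable summand of every \<open>\<^sup>eR\<close> is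
  already a summand of \<open>\<^sup>fR\<close>: each of the finitely many classes occurs at some level, and by the
  splitting it occurs at all higher levels (\<open>generating_level_exists\<close>).  With this \<open>f\<close>, the
  projections onto the summands of \<open>\<^sup>NR\<close> factor through \<open>\<^sup>fR\<close>, so they lie in \<open>I\<close>, and so does their sum 1.
\<close>

section \<open>Binomial expansion in characteristic p\<close>

text \<open>A family satisfying Pascal's recurrence is a binomial sum of its values at level 0.  The two
instances needed are \<open>T n i j = x ^ i * y ^ j * (x + y) ^ n\<close> and a family built from the iterated
commutators of an additive map; for a bare family in an abelian group, the second does not require
the commutative ring generated by the multiplication operators.\<close>
lemma (in abelian_group) binomial_recurrence:
  fixes T :: "nat \<Rightarrow> nat \<Rightarrow> nat \<Rightarrow> 'a"
  assumes closed: "\<And>n i j. T n i j \<in> carrier G"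
    and step: "\<And>n i j. T (Suc n) i j = T n (Suc i) j \<oplus> T n i (Suc j)"
  shows "T n i j = (\<Oplus>k\<in>{..n}. [(n choose k)] \<cdot> T 0 (i + (n - k)) (j + k))"
proof (induction n arbitrary: i j)
  case 0
  then show ?case using closed by simp
next
  case (Suc n)
  define g where "g k = T 0 (i + (Suc n - k)) (j + k)" for k
  have g: "g k \<in> carrier G" for k using closed by (simp add: g_def)
  have "T n (Suc i) j = (\<Oplus>k\<in>{..n}. [(n choose k)] \<cdot> g k)"
    unfolding Suc using closed
    by (intro finsum_cong') (auto simp: g_def Suc_diff_le)
  also have "\<dots> = (\<Oplus>k\<in>{..Suc n}. [(n choose k)] \<cdot> g k)"
    using g by (simp add: binomial_eq_0 Pi_def)
  finally have 1: "T n (Suc i) j = (\<Oplus>k\<in>{..Suc n}. [(n choose k)] \<cdot> g k)" .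
  define c where "c k = (case k of 0 \<Rightarrow> 0 | Suc k' \<Rightarrow> n choose k')" for k
  have "T n i (Suc j) = (\<Oplus>k\<in>{..n}. [(n choose k)] \<cdot> g (Suc k))"
    unfolding Suc using closed
    by (intro finsum_cong') (auto simp: g_def)
  also have "\<dots> = (\<Oplus>k\<in>{..Suc n}. [(c k)] \<cdot> g k)"
    using g by (subst finsum_Suc2) (auto simp: c_def Pi_def)
  finally have 2: "T n i (Suc j) = (\<Oplus>k\<in>{..Suc n}. [(c k)] \<cdot> g k)" .
  have "T (Suc n) i j = (\<Oplus>k\<in>{..Suc n}. [(n choose k)] \<cdot> g k \<oplus> [(c k)] \<cdot> g k)"
    unfolding step 1 2 using g by (subst finsum_addf) (auto simp: Pi_def)
  also have "\<dots> = (\<Oplus>k\<in>{..Suc n}. [(Suc n choose k)] \<cdot> g k)"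
  proof (intro finsum_cong')
    fix k assume "k \<in> {..Suc n}"
    have "(n choose k) + c k = Suc n choose k"
      by (cases k) (auto simp: c_def)
    then show "[(n choose k)] \<cdot> g k \<oplus> [(c k)] \<cdot> g k = [(Suc n choose k)] \<cdot> g k"
      using add.nat_pow_mult[OF g[of k], of "n choose k" "c k"] by simp
  qed (use g in auto)
  finally show ?case by (simp only: g_def)
qed

locale prime_char_ring = cring R for R (structure) +
  fixes p :: nat
  assumes p_prime: "Factorial_Ring.prime p" and char_p: "has_char R p"
begin

lemma p_times: "x \<in> carrier R \<Longrightarrow> p dvd n \<Longrightarrow> [n] \<cdot> x = \<zero>"
proof -
  assume x: "x \<in> carrier R" and n: "p dvd n"
  have "[n] \<cdot> x = ([n] \<cdot> \<one>) \<otimes> x"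
    using x by (simp add: add_pow_ldistr)
  also have "[n] \<cdot> \<one> = \<zero>"
    using char_p n by (simp add: has_char_def)
  finally show ?thesis using x by simp
qed

lemma one_neq_zero: "\<one> \<noteq> \<zero>"
proof
  assume "\<one> = \<zero>"
  then have "[(1::nat)] \<cdot> \<one> = \<zero>" by simp
  then have "p dvd 1" using char_p unfolding has_char_def by blast
  then show False using p_prime by simp
qed

lemma p_gt_0: "0 < p" using p_prime by (simp add: prime_gt_0_nat)

text \<open>In characteristic \<open>p\<close> the inner binomial coefficients of level \<open>p\<close> vanish.\<close>
lemma freshman_recurrence:
  fixes T :: "nat \<Rightarrow> nat \<Rightarrow> nat \<Rightarrow> 'a"
  assumes closed: "\<And>n i j. T n i j \<in> carrier R"
    and step: "\<And>n i j. T (Suc n) i j = T n (Suc i) j \<oplus> T n i (Suc j)"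
  shows "T p 0 0 = T 0 p 0 \<oplus> T 0 0 p"
proof -
  obtain m where m: "p = Suc (Suc m)"
    using prime_ge_2_nat[OF p_prime] by (metis add_2_eq_Suc le_Suc_ex)
  define h where "h k = [(p choose k)] \<cdot> T 0 (p - k) k" for k
  have h: "h k \<in> carrier R" for k using closed by (simp add: h_def)
  have mid: "h (Suc k) = \<zero>" if "k \<in> {..m}" for k
  proof -
    have "p dvd (p choose Suc k)"
      by (rule dvd_choose_prime) (use that m p_prime in auto)
    then show ?thesis using closed by (simp add: h_def p_times)
  qed
  have "T p 0 0 = (\<Oplus>k\<in>{..p}. h k)"
    using binomial_recurrence[of T p 0 0, OF closed step] by (simp add: h_def)
  also have "\<dots> = h p \<oplus> (\<Oplus>k\<in>{..Suc m}. h k)"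
    using h unfolding m by (subst finsum_Suc) auto
  also have "(\<Oplus>k\<in>{..Suc m}. h k) = (\<Oplus>k\<in>{..m}. h (Suc k)) \<oplus> h 0"
    using h by (subst finsum_Suc2) auto
  also have "(\<Oplus>k\<in>{..m}. h (Suc k)) = \<zero>"
    using mid by (rule add.finprod_one_eqI)
  finally show ?thesis using h closed by (simp add: h_def a_comm)
qed

lemma frobenius_add:
  assumes x: "x \<in> carrier R" and y: "y \<in> carrier R"
  shows "(x \<oplus> y) [^] (p ^ k) = x [^] (p ^ k) \<oplus> y [^] (p ^ k)"
proof -
  have one: "(x \<oplus> y) [^] p = x [^] p \<oplus> y [^] p" if x: "x \<in> carrier R" and y: "y \<in> carrier R" for x y
  proof -
    let ?T = "\<lambda>n i j. (x [^] i \<otimes> y [^] j) \<otimes> (x \<oplus> y) [^] n"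
    have "?T p (0::nat) (0::nat) = ?T (0::nat) p (0::nat) \<oplus> ?T (0::nat) (0::nat) p"
    proof (rule freshman_recurrence)
      fix n i j :: nat
      let ?z = "(x \<oplus> y) [^] n"
      have "?T (Suc n) i j = (x [^] i \<otimes> y [^] j) \<otimes> (?z \<otimes> (x \<oplus> y))" by simp
      also have "\<dots> = (x [^] i \<otimes> x \<otimes> y [^] j) \<otimes> ?z \<oplus> (x [^] i \<otimes> (y [^] j \<otimes> y)) \<otimes> ?z"
        using x y nat_pow_closed[of "x \<oplus> y" n] nat_pow_closed[OF x, of i] nat_pow_closed[OF y, of j]
          a_closed[OF x y]
        by algebra
      finally show "?T (Suc n) i j = ?T n (Suc i) j \<oplus> ?T n i (Suc j)" by simp
    qed (use x y in auto)
    then show ?thesis using x y by simp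
  qed
  show ?thesis
  proof (induction k)
    case 0
    then show ?case using x y by simp
  next
    case (Suc k)
    have "(x \<oplus> y) [^] (p ^ Suc k) = ((x \<oplus> y) [^] (p ^ k)) [^] p"
      using x y by (simp add: nat_pow_pow mult.commute)
    also have "\<dots> = (x [^] (p ^ k)) [^] p \<oplus> (y [^] (p ^ k)) [^] p"
      using x y by (simp add: Suc one)
    finally show ?case using x y by (simp add: nat_pow_pow mult.commute)
  qed
qed

end

section \<open>Maps linear up to powers of Frobenius\<close>

context prime_char_ring begin

text \<open>All the modules \<open>\<^sup>eR\<close> share one underlying group, so it pays to regard an \<open>R\<close>-linear map
\<open>\<^sup>aR \<rightarrow> \<^sup>bR\<close> as a function on \<open>R\<close> whose type remembers only \<open>a\<close> and \<open>b\<close>.  Then \<open>Hom e e\<close> is the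
endomorphism ring of \<open>R\<close> over its subring of \<open>p^e\<close>-th powers, and restricting scalars along
Frobenius (\<open>Hom_shift\<close>) does not change the function at all.\<close>
definition Hom :: "nat \<Rightarrow> nat \<Rightarrow> ('a \<Rightarrow> 'a) set"
  where "Hom a b = mod_hom R (frobenius_module p a R) (frobenius_module p b R)"

lemma Hom_iff: "f \<in> Hom a b \<longleftrightarrow> f \<in> carrier R \<rightarrow>\<^sub>E carrier R \<and>
    (\<forall>x \<in> carrier R. \<forall>y \<in> carrier R. f (x \<oplus> y) = f x \<oplus> f y) \<and>
    (\<forall>r \<in> carrier R. \<forall>x \<in> carrier R. f (r [^] (p ^ a) \<otimes> x) = r [^] (p ^ b) \<otimes> f x)"
  by (simp add: Hom_def mod_hom_def frobenius_module_def with_action_def)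

lemma HomI:
  assumes "\<And>x. x \<in> carrier R \<Longrightarrow> f x \<in> carrier R"
    and "\<And>x y. x \<in> carrier R \<Longrightarrow> y \<in> carrier R \<Longrightarrow> f (x \<oplus> y) = f x \<oplus> f y"
    and "\<And>r x. r \<in> carrier R \<Longrightarrow> x \<in> carrier R \<Longrightarrow> f (r [^] (p ^ a) \<otimes> x) = r [^] (p ^ b) \<otimes> f x"
  shows "restrict f (carrier R) \<in> Hom a b"
  using assms by (auto simp: Hom_iff)

lemma Hom_closed: "f \<in> Hom a b \<Longrightarrow> x \<in> carrier R \<Longrightarrow> f x \<in> carrier R"
  and Hom_add: "f \<in> Hom a b \<Longrightarrow> x \<in> carrier R \<Longrightarrow> y \<in> carrier R \<Longrightarrow> f (x \<oplus> y) = f x \<oplus> f y"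
  and Hom_smult: "f \<in> Hom a b \<Longrightarrow> r \<in> carrier R \<Longrightarrow> x \<in> carrier R \<Longrightarrow>
    f (r [^] (p ^ a) \<otimes> x) = r [^] (p ^ b) \<otimes> f x"
  and Hom_ext: "f \<in> Hom a b \<Longrightarrow> f \<in> extensional (carrier R)"
  by (auto simp: Hom_iff PiE_def)

lemma Hom_compose:
  "f \<in> Hom a b \<Longrightarrow> g \<in> Hom b c \<Longrightarrow> compose (carrier R) g f \<in> Hom a c"
  unfolding compose_def by (rule HomI) (simp_all add: Hom_closed Hom_add Hom_smult)

lemma Hom_shift:
  assumes f: "f \<in> Hom a b" shows "f \<in> Hom (a + k) (b + k)"
proof -
  have "f (r [^] (p ^ (a + k)) \<otimes> x) = r [^] (p ^ (b + k)) \<otimes> f x"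
    if "r \<in> carrier R" "x \<in> carrier R" for r x
    using Hom_smult[OF f, of "r [^] (p ^ k)" x] that
    by (simp add: nat_pow_pow power_add mult.commute)
  then show ?thesis using f by (simp add: Hom_iff)
qed

lemma Hom_mono: "e \<le> e' \<Longrightarrow> Hom e e \<subseteq> Hom e' e'"
  using Hom_shift[of _ e e "e' - e"] by auto

definition Frob :: "nat \<Rightarrow> 'a \<Rightarrow> 'a"
  where "Frob k = (\<lambda>x \<in> carrier R. x [^] (p ^ k))"

lemma Frob_Hom: "Frob k \<in> Hom a (a + k)"
  unfolding Frob_def
  by (rule HomI) (simp_all add: frobenius_add nat_pow_distrib nat_pow_pow power_add)

lemma mult_Hom: "c \<in> carrier R \<Longrightarrow> (\<lambda>x \<in> carrier R. c \<otimes> x) \<in> Hom a a"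
  by (rule HomI) (simp_all add: r_distr m_lcomm)

lemma id_Hom: "(\<lambda>x \<in> carrier R. x) \<in> Hom a a"
  by (rule HomI) simp_all

end

section \<open>Commutators and differential operators\<close>

context prime_char_ring begin

definition commutator :: "'a \<Rightarrow> ('a \<Rightarrow> 'a) \<Rightarrow> 'a \<Rightarrow> 'a"
  where "commutator r \<theta> = (\<lambda>x \<in> carrier R. (r \<otimes> \<theta> x) \<ominus> \<theta> (r \<otimes> x))"

definition zero_map :: "'a \<Rightarrow> 'a"
  where "zero_map = (\<lambda>x \<in> carrier R. \<zero>)"

lemma zero_map_apply [simp]: "x \<in> carrier R \<Longrightarrow> zero_map x = \<zero>"
  by (simp add: zero_map_def)

lemma commutator_apply: "x \<in> carrier R \<Longrightarrow> commutator r \<theta> x = (r \<otimes> \<theta> x) \<ominus> \<theta> (r \<otimes> x)"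
  by (simp add: commutator_def)

lemma commutator_eq_zero_iff:
  assumes "\<theta> \<in> carrier R \<rightarrow> carrier R" "r \<in> carrier R"
  shows "commutator r \<theta> = zero_map \<longleftrightarrow> (\<forall>x \<in> carrier R. \<theta> (r \<otimes> x) = r \<otimes> \<theta> x)"
proof -
  have "(r \<otimes> \<theta> x) \<ominus> \<theta> (r \<otimes> x) = \<zero> \<longleftrightarrow> \<theta> (r \<otimes> x) = r \<otimes> \<theta> x" if "x \<in> carrier R" for x
    using that assms by (subst r_right_minus_eq) (auto simp: Pi_iff)
  then show ?thesis
    by (auto simp: commutator_def zero_map_def fun_eq_iff restrict_def)
qed

lemma Hom_zero: "f \<in> Hom a b \<Longrightarrow> f \<zero> = \<zero>"
  using Hom_add[of f a b \<zero> \<zero>] Hom_closed[of f a b \<zero>] by (simp add: add.r_cancel_one')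

lemma commutator_Hom:
  assumes \<theta>: "\<theta> \<in> Hom a b" and r: "r \<in> carrier R"
  shows "commutator r \<theta> \<in> Hom a b"
  unfolding commutator_def
proof (rule HomI)
  fix x y assume x: "x \<in> carrier R" and y: "y \<in> carrier R"
  show "(r \<otimes> \<theta> x) \<ominus> \<theta> (r \<otimes> x) \<in> carrier R"
    using \<theta> r x by (simp add: Hom_closed)
  have c: "\<theta> x \<in> carrier R" "\<theta> y \<in> carrier R" "\<theta> (r \<otimes> x) \<in> carrier R" "\<theta> (r \<otimes> y) \<in> carrier R"
    using \<theta> r x y by (simp_all add: Hom_closed)
  show "(r \<otimes> \<theta> (x \<oplus> y)) \<ominus> \<theta> (r \<otimes> (x \<oplus> y)) =
      ((r \<otimes> \<theta> x) \<ominus> \<theta> (r \<otimes> x)) \<oplus> ((r \<otimes> \<theta> y) \<ominus> \<theta> (r \<otimes> y))"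
    using \<theta> r x y c by (simp add: Hom_add r_distr, algebra)
next
  fix s x assume s: "s \<in> carrier R" and x: "x \<in> carrier R"
  have c: "\<theta> x \<in> carrier R" "\<theta> (r \<otimes> x) \<in> carrier R" "s [^] p ^ b \<in> carrier R"
    using \<theta> r x s by (simp_all add: Hom_closed)
  have "\<theta> (r \<otimes> (s [^] p ^ a \<otimes> x)) = s [^] p ^ b \<otimes> \<theta> (r \<otimes> x)"
    using Hom_smult[OF \<theta> s, of "r \<otimes> x"] r s x by (simp add: m_lcomm)
  then show "(r \<otimes> \<theta> (s [^] p ^ a \<otimes> x)) \<ominus> \<theta> (r \<otimes> (s [^] p ^ a \<otimes> x)) =
      s [^] p ^ b \<otimes> ((r \<otimes> \<theta> x) \<ominus> \<theta> (r \<otimes> x))"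
    using Hom_smult[OF \<theta> s x] r c by (simp, algebra)
qed

lemma commutator_commute:
  assumes \<theta>: "\<theta> \<in> Hom a b" and r: "r \<in> carrier R" and s: "s \<in> carrier R"
  shows "commutator r (commutator s \<theta>) = commutator s (commutator r \<theta>)"
proof -
  have "commutator r (commutator s \<theta>) x = commutator s (commutator r \<theta>) x" if x: "x \<in> carrier R" for x
  proof -
    have c: "\<theta> x \<in> carrier R" "\<theta> (r \<otimes> x) \<in> carrier R" "\<theta> (s \<otimes> x) \<in> carrier R"
      "\<theta> (r \<otimes> (s \<otimes> x)) \<in> carrier R"
      using \<theta> r s x by (simp_all add: Hom_closed)
    have "s \<otimes> (r \<otimes> x) = r \<otimes> (s \<otimes> x)" using r s x by (simp add: m_lcomm)
    then show ?thesis
      using r s x c by (simp add: commutator_apply, algebra)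
  qed
  then show ?thesis by (auto simp: commutator_def fun_eq_iff)
qed

lemma funpow_commutator_Hom:
  "\<theta> \<in> Hom a b \<Longrightarrow> u \<in> carrier R \<Longrightarrow> (commutator u ^^ n) \<theta> \<in> Hom a b"
  by (induction n) (simp_all add: commutator_Hom)

lemma minus_one_pow_p: "(\<ominus> \<one>) [^] p = \<ominus> \<one>"
proof -
  have "(\<ominus> \<one> \<oplus> \<one>) [^] p = (\<ominus> \<one>) [^] p \<oplus> \<one> [^] p"
    using frobenius_add[of "\<ominus> \<one>" \<one> 1] by simp
  then have "(\<ominus> \<one>) [^] p \<oplus> \<one> = \<zero>"
    using p_gt_0 by (simp add: l_neg nat_pow_zero)
  then show ?thesis by (intro minus_equality[symmetric]) simp_all
qed

text \<open>Left multiplication by \<open>u\<close> and precomposition with multiplication by \<open>u\<close> commute as operators on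
additive maps, and the commutator is their difference, so this is the freshman's dream again.  The sign
\<open>(-1) ^ p\<close> is \<open>-1\<close> also for \<open>p = 2\<close>.\<close>
lemma commutator_pow_p:
  assumes \<theta>: "\<theta> \<in> Hom a b" and u: "u \<in> carrier R"
  shows "(commutator u ^^ p) \<theta> = commutator (u [^] p) \<theta>"
proof -
  have "(commutator u ^^ p) \<theta> x = commutator (u [^] p) \<theta> x" if x: "x \<in> carrier R" for x
  proof -
    let ?ad = "\<lambda>n. (commutator u ^^ n) \<theta>"
    have ad: "?ad n y \<in> carrier R" if "y \<in> carrier R" for n y
      using funpow_commutator_Hom[OF \<theta> u] that by (rule Hom_closed)
    let ?T = "\<lambda>n i j. (\<ominus> \<one>) [^] j \<otimes> (u [^] i \<otimes> ?ad n (u [^] j \<otimes> x))"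
    have "?T p (0::nat) (0::nat) = ?T (0::nat) p (0::nat) \<oplus> ?T (0::nat) (0::nat) p"
    proof (rule freshman_recurrence)
      fix n i j :: nat
      let ?y = "u [^] j \<otimes> x"
      have y: "?y \<in> carrier R" using u x by simp
      have c: "?ad n ?y \<in> carrier R" "?ad n (u \<otimes> ?y) \<in> carrier R" "(\<ominus> \<one>) [^] j \<in> carrier R"
        "u [^] i \<in> carrier R"
        using ad u y by simp_all
      have "?T (Suc n) i j = (\<ominus> \<one>) [^] j \<otimes> (u [^] i \<otimes> ((u \<otimes> ?ad n ?y) \<ominus> ?ad n (u \<otimes> ?y)))"
        using y by (simp add: commutator_apply)
      also have "\<dots> = (\<ominus> \<one>) [^] j \<otimes> (u [^] i \<otimes> u \<otimes> ?ad n ?y) \<oplus>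
          ((\<ominus> \<one>) [^] j \<otimes> \<ominus> \<one>) \<otimes> (u [^] i \<otimes> ?ad n (u \<otimes> ?y))"
        using c u by algebra
      also have "u \<otimes> ?y = u [^] Suc j \<otimes> x"
        using u x nat_pow_closed[OF u, of j] by (simp add: m_ac)
      finally show "?T (Suc n) i j = ?T n (Suc i) j \<oplus> ?T n i (Suc j)" by simp
    qed (use ad u x in auto)
    then have "?ad p x = u [^] p \<otimes> \<theta> x \<oplus> (\<ominus> \<one>) [^] p \<otimes> \<theta> (u [^] p \<otimes> x)"
      using ad[of _ 0] ad[of _ p] u x \<theta> by (simp add: Hom_closed)
    also have "\<dots> = u [^] p \<otimes> \<theta> x \<ominus> \<theta> (u [^] p \<otimes> x)"
      using u x \<theta> by (simp add: minus_one_pow_p Hom_closed minus_eq l_minus)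
    finally show ?thesis using x by (simp add: commutator_apply)
  qed
  moreover have "(commutator u ^^ p) \<theta> \<in> Hom a b" "commutator (u [^] p) \<theta> \<in> Hom a b"
    using \<theta> u by (simp_all add: funpow_commutator_Hom commutator_Hom)
  ultimately show ?thesis
    by (intro extensionalityI[of _ "carrier R"]) (auto dest: Hom_ext)
qed

lemma commutator_nilpotent:
  assumes \<theta>: "\<theta> \<in> Hom e e" and u: "u \<in> carrier R" and n: "p ^ e \<le> n"
  shows "(commutator u ^^ n) \<theta> = zero_map"
proof -
  have pow: "(commutator u ^^ (p ^ k)) \<eta> = commutator (u [^] (p ^ k)) \<eta>" if "\<eta> \<in> Hom e e" for k \<eta>
    using that
  proof (induction k arbitrary: \<eta>)
    case 0
    then show ?case using u by simp
  next
    case (Suc k)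
    have iter: "((commutator u ^^ (p ^ k)) ^^ m) \<eta> = (commutator (u [^] (p ^ k)) ^^ m) \<eta>" for m
    proof (induction m)
      case (Suc m)
      have "(commutator (u [^] (p ^ k)) ^^ m) \<eta> \<in> Hom e e"
        using \<open>\<eta> \<in> Hom e e\<close> u by (simp add: funpow_commutator_Hom)
      then show ?case using Suc.IH \<open>\<And>\<eta>. \<eta> \<in> Hom e e \<Longrightarrow> _ = _\<close> by simp
    qed simp
    have "(commutator u ^^ (p ^ Suc k)) \<eta> = ((commutator u ^^ (p ^ k)) ^^ p) \<eta>"
      by (simp add: funpow_mult mult.commute)
    also have "\<dots> = commutator ((u [^] (p ^ k)) [^] p) \<eta>"
      using iter Suc.prems u by (simp add: commutator_pow_p)
    finally show ?case using u by (simp add: nat_pow_pow mult.commute)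
  qed
  have *: "(commutator u ^^ (p ^ e)) \<eta> = zero_map" if "\<eta> \<in> Hom e e" for \<eta>
    using pow[OF that, of e] that u
    by (simp add: commutator_eq_zero_iff Hom_smult Hom_closed)
  have "(commutator u ^^ n) \<theta> = (commutator u ^^ (p ^ e)) ((commutator u ^^ (n - p ^ e)) \<theta>)"
    using n by (metis comp_apply funpow_add le_add_diff_inverse)
  then show ?thesis using * \<theta> u by (simp add: funpow_commutator_Hom)
qed

abbreviation diff_le :: "nat \<Rightarrow> ('a \<Rightarrow> 'a) set"
  where "diff_le \<equiv> diff_ops_order \<Z> (int_algebra R)"

lemma a_inv_with_action: "a_inv (with_action R act) = a_inv R"
  by (simp add: fun_eq_iff with_action_def a_inv_def m_inv_def)

lemma diff_le_0: "diff_le 0 = Hom 0 0"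
  by (auto simp: Hom_iff mod_hom_def int_algebra_def regular_module_def with_action_def)

lemma add_map_int_pow:
  assumes "f \<in> carrier R \<rightarrow> carrier R"
    "\<And>x y. x \<in> carrier R \<Longrightarrow> y \<in> carrier R \<Longrightarrow> f (x \<oplus> y) = f x \<oplus> f y" "x \<in> carrier R"
  shows "f (add_pow R (n::int) x) = add_pow R n (f x)"
proof -
  have "group_hom (add_monoid R) (add_monoid R) f"
    using assms by (intro group_hom.intro group_hom_axioms.intro a_group) (auto simp: hom_def)
  from group_hom.hom_int_pow[OF this, of x n] show ?thesis
    using assms by (simp add: add_pow_def)
qed

lemma diff_le_Suc: "\<theta> \<in> diff_le (Suc n) \<longleftrightarrow> \<theta> \<in> carrier R \<rightarrow>\<^sub>E carrier R \<and>
    (\<forall>x \<in> carrier R. \<forall>y \<in> carrier R. \<theta> (x \<oplus> y) = \<theta> x \<oplus> \<theta> y) \<and>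
    (\<forall>r \<in> carrier R. commutator r \<theta> \<in> diff_le n)"
proof -
  have "mod_hom \<Z> (int_algebra R) (int_algebra R) = {f \<in> carrier R \<rightarrow>\<^sub>E carrier R.
      \<forall>x \<in> carrier R. \<forall>y \<in> carrier R. f (x \<oplus> y) = f x \<oplus> f y}"
    by (auto simp: mod_hom_def int_algebra_def with_action_def intro!: add_map_int_pow)
  moreover have "(\<lambda>x \<in> carrier (int_algebra R). (r \<otimes>\<^bsub>int_algebra R\<^esub> \<theta> x) \<ominus>\<^bsub>int_algebra R\<^esub> \<theta> (r \<otimes>\<^bsub>int_algebra R\<^esub> x))
      = commutator r \<theta>" for r
    unfolding a_minus_def
    by (simp add: int_algebra_def a_inv_with_action commutator_def a_minus_def)
      (simp add: with_action_def)
  moreover have "carrier (int_algebra R) = carrier R"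
    by (simp add: int_algebra_def with_action_def)
  ultimately show ?thesis by simp
qed

declare diff_ops_order.simps [simp del]

text \<open>Let \<open>s = r ^ (p ^ n)\<close>.  By induction the commutator of \<open>s\<close> with \<open>\<theta>\<close> is linear over
\<open>p ^ n\<close>-th powers, hence commutes with \<open>s\<close>; taking commutators is a derivation in its first argument,
so the commutator with \<open>s ^ p\<close> is \<open>p * s ^ (p - 1)\<close> times something, which is zero.\<close>
lemma diff_le_subset_Hom: "diff_le n \<subseteq> Hom n n"
proof (induction n)
  case 0
  then show ?case using diff_le_0 by simp
next
  case (Suc n)
  show ?case
  proof
    fix \<theta> assume \<theta>: "\<theta> \<in> diff_le (Suc n)"
    then have ext: "\<theta> \<in> carrier R \<rightarrow>\<^sub>E carrier R"
      and add: "\<And>x y. x \<in> carrier R \<Longrightarrow> y \<in> carrier R \<Longrightarrow> \<theta> (x \<oplus> y) = \<theta> x \<oplus> \<theta> y"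
      by (simp_all add: diff_le_Suc)
    have "\<theta> (r [^] (p ^ Suc n) \<otimes> x) = r [^] (p ^ Suc n) \<otimes> \<theta> x"
      if r: "r \<in> carrier R" and x: "x \<in> carrier R" for r x
    proof -
      let ?s = "r [^] (p ^ n)"
      let ?d = "commutator ?s \<theta>"
      have s: "?s \<in> carrier R" using r by simp
      have d: "?d \<in> Hom n n"
        using \<theta> s Suc.IH by (auto simp: diff_le_Suc)
      have dx: "?d x \<in> carrier R" using d x by (rule Hom_closed)
      have \<theta>x: "\<theta> x \<in> carrier R" using ext x by auto
      have "\<theta> (?s [^] Suc k \<otimes> x) = (?s [^] Suc k \<otimes> \<theta> x) \<ominus> add_pow R (Suc k) (?s [^] k \<otimes> ?d x)" for k
      proof (induction k)
        case 0
        have "\<theta> (?s \<otimes> x) \<in> carrier R" using ext s x by auto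
        then show ?case
          using s x \<theta>x by (simp add: commutator_apply) algebra
      next
        case (Suc k)
        let ?y = "?s [^] Suc k \<otimes> x"
        let ?m = "add_pow R (Suc k) (?s [^] k \<otimes> ?d x)"
        have y: "?y \<in> carrier R" using s x by simp
        have yc: "\<theta> ?y \<in> carrier R" "\<theta> (?s \<otimes> ?y) \<in> carrier R" using ext s y by auto
        have m: "?m \<in> carrier R" using s dx by simp
        have sk: "?s [^] Suc k \<in> carrier R" using s by simp
        have dy: "?d ?y = ?s [^] Suc k \<otimes> ?d x"
          using Hom_smult[OF d, of "r [^] Suc k" x] r x
          by (simp only: nat_pow_pow[OF r] mult.commute[of "p ^ n"] nat_pow_closed)
        have "\<theta> (?s \<otimes> ?y) = (?s \<otimes> \<theta> ?y) \<ominus> ?d ?y"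
          using y s yc by (simp only: commutator_apply) algebra
        also have "\<dots> = (?s \<otimes> ((?s [^] Suc k \<otimes> \<theta> x) \<ominus> ?m)) \<ominus> (?s [^] Suc k \<otimes> ?d x)"
          by (simp only: Suc.IH dy)
        also have "\<dots> = (?s [^] Suc k \<otimes> ?s \<otimes> \<theta> x) \<ominus> ((?s \<otimes> ?m) \<oplus> (?s [^] Suc k \<otimes> ?d x))"
          using s \<theta>x dx m sk by algebra
        also have "?s \<otimes> ?m = add_pow R (Suc k) (?s [^] Suc k \<otimes> ?d x)"
          using s dx by (simp add: add_pow_rdistr m_ac del: add.nat_pow_Suc)
        finally show ?case
          using s x by (simp add: m_ac)
      qed
      from this[of "p - 1"] have "\<theta> (?s [^] p \<otimes> x) = ?s [^] p \<otimes> \<theta> x"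
        using p_gt_0 p_times[of "?s [^] (p - 1) \<otimes> ?d x" p] s dx \<theta>x by (simp add: minus_eq)
      then show ?thesis using r by (simp add: nat_pow_pow mult.commute)
    qed
    then show "\<theta> \<in> Hom (Suc n) (Suc n)"
      using ext add by (simp add: Hom_iff)
  qed
qed

text \<open>The set \<open>U\<close> generates \<open>\<^sup>eR\<close> as an \<open>R\<close>-module.  The formulation by closed subsets avoids
coefficient families: every use below shows that a condition on ring elements is closed under the
module operations.\<close>
definition frob_generates :: "nat \<Rightarrow> 'a set \<Rightarrow> bool"
  where "frob_generates e U \<longleftrightarrow> U \<subseteq> carrier R \<and>
    (\<forall>W. U \<subseteq> W \<and> \<zero> \<in> W \<and> (\<forall>x \<in> W. \<forall>y \<in> W. x \<oplus> y \<in> W) \<and>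
      (\<forall>r \<in> carrier R. \<forall>x \<in> W. r [^] (p ^ e) \<otimes> x \<in> W) \<longrightarrow> carrier R \<subseteq> W)"

lemma frob_generatesD:
  assumes "frob_generates e U" "U \<subseteq> W" "\<zero> \<in> W" "\<And>x y. x \<in> W \<Longrightarrow> y \<in> W \<Longrightarrow> x \<oplus> y \<in> W"
    "\<And>r x. r \<in> carrier R \<Longrightarrow> x \<in> W \<Longrightarrow> r [^] (p ^ e) \<otimes> x \<in> W" "x \<in> carrier R"
  shows "x \<in> W"
proof -
  have "carrier R \<subseteq> W"
    using assms(1)[unfolded frob_generates_def, THEN conjunct2, rule_format, of W] assms(2-5) by simp
  then show ?thesis using assms(6) by blast
qed

text \<open>Commuting with multiplication by \<open>r\<close> is a condition on \<open>r\<close> that defines a submodule of \<open>\<^sup>eR\<close>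
when \<open>\<theta>\<close> is an endomorphism of \<open>\<^sup>eR\<close>, so it can be tested on generators.\<close>
lemma Hom_0_0I:
  assumes U: "frob_generates e U" and \<theta>: "\<theta> \<in> Hom e e"
    and comm: "\<And>u. u \<in> U \<Longrightarrow> commutator u \<theta> = zero_map"
  shows "\<theta> \<in> Hom 0 0"
proof -
  let ?W = "{r \<in> carrier R. \<forall>x \<in> carrier R. \<theta> (r \<otimes> x) = r \<otimes> \<theta> x}"
  have UR: "U \<subseteq> carrier R" using U by (simp add: frob_generates_def)
  have cl: "\<theta> \<in> carrier R \<rightarrow> carrier R" using \<theta> by (auto simp: Hom_closed)
  have "r \<in> ?W" if "r \<in> carrier R" for r
  proof (rule frob_generatesD[OF U _ _ _ _ that])
    show "U \<subseteq> ?W" using comm UR commutator_eq_zero_iff[OF cl] by blast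
    show "\<zero> \<in> ?W" using \<theta> by (auto simp: Hom_zero Hom_closed)
    show "r \<oplus> s \<in> ?W" if "r \<in> ?W" "s \<in> ?W" for r s
      using that \<theta> by (auto simp: l_distr Hom_add Hom_closed)
    show "s [^] (p ^ e) \<otimes> r \<in> ?W" if "s \<in> carrier R" "r \<in> ?W" for s r
      using that \<theta> by (auto simp: m_assoc Hom_smult Hom_closed)
  qed
  then show ?thesis using \<theta> by (simp add: Hom_iff)
qed

lemma fold_commutator_Hom:
  "\<theta> \<in> Hom a b \<Longrightarrow> set w \<subseteq> carrier R \<Longrightarrow> fold commutator w \<theta> \<in> Hom a b"
  by (induction w arbitrary: \<theta>) (simp_all add: commutator_Hom)

lemma fold_commutator_commute:
  "\<theta> \<in> Hom a b \<Longrightarrow> set w \<subseteq> carrier R \<Longrightarrow> r \<in> carrier R \<Longrightarrow>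
    fold commutator w (commutator r \<theta>) = commutator r (fold commutator w \<theta>)"
proof (induction w arbitrary: \<theta>)
  case (Cons s w)
  then have "commutator s (commutator r \<theta>) = commutator r (commutator s \<theta>)"
    using commutator_commute[of \<theta> a b s r] by simp
  then show ?case using Cons by (simp add: commutator_Hom)
qed simp

text \<open>Because commutators commute with each other, the order of \<open>\<theta>\<close> can be measured with commutators
by generators alone.\<close>
lemma diff_leI:
  assumes U: "frob_generates e U"
  shows "\<theta> \<in> Hom e e \<Longrightarrow>
    (\<And>w. set w \<subseteq> U \<Longrightarrow> length w = Suc n \<Longrightarrow> fold commutator w \<theta> = zero_map) \<Longrightarrow> \<theta> \<in> diff_le n"
proof (induction n arbitrary: \<theta>)
  case 0
  have "commutator u \<theta> = zero_map" if "u \<in> U" for u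
    using 0(2)[of "[u]"] that by simp
  then show ?case using Hom_0_0I[OF U 0(1)] diff_le_0 by simp
next
  case (Suc n)
  have UR: "U \<subseteq> carrier R" using U by (simp add: frob_generates_def)
  have "commutator r \<theta> \<in> diff_le n" if r: "r \<in> carrier R" for r
  proof (rule Suc.IH)
    show "commutator r \<theta> \<in> Hom e e" using Suc.prems(1) r by (rule commutator_Hom)
    fix w assume w: "set w \<subseteq> U" "length w = Suc n"
    let ?\<eta> = "fold commutator w \<theta>"
    have \<eta>: "?\<eta> \<in> Hom e e" using Suc.prems(1) w UR by (intro fold_commutator_Hom) auto
    have "?\<eta> \<in> Hom 0 0"
    proof (rule Hom_0_0I[OF U \<eta>])
      fix u assume "u \<in> U"
      then show "commutator u ?\<eta> = zero_map"
        using Suc.prems(2)[of "w @ [u]"] w by simp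
    qed
    then have "commutator r ?\<eta> = zero_map"
      using r Hom_smult[of ?\<eta> 0 0 r] by (subst commutator_eq_zero_iff) (auto simp: Hom_closed)
    then show "fold commutator w (commutator r \<theta>) = zero_map"
      using fold_commutator_commute[OF Suc.prems(1) _ r, of w] w UR by auto
  qed
  then show ?case using Suc.prems(1) by (auto simp: diff_le_Suc Hom_iff)
qed

text \<open>In a long enough word in finitely many generators some generator occurs \<open>p ^ e\<close> times; after
moving these occurrences to the front, \<open>commutator_nilpotent\<close> kills the operator.\<close>
lemma Hom_subset_diff_le:
  assumes U: "frob_generates e U" and fin: "finite U"
  shows "Hom e e \<subseteq> diff_le (card U * p ^ e)"
proof
  fix \<theta> assume \<theta>: "\<theta> \<in> Hom e e"
  have UR: "U \<subseteq> carrier R" using U by (simp add: frob_generates_def)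
  show "\<theta> \<in> diff_le (card U * p ^ e)"
  proof (rule diff_leI[OF U \<theta>])
    fix w assume w: "set w \<subseteq> U" and len: "length w = Suc (card U * p ^ e)"
    have "\<exists>u \<in> U. p ^ e \<le> count_list w u"
    proof (rule ccontr)
      assume "\<not> ?thesis"
      then have "sum (count_list w) U \<le> card U * p ^ e"
        by (intro sum_bounded_above[where 'a = nat, simplified]) auto
      moreover have "sum (count_list w) U = length w"
        using sum_count_set[OF w fin] .
      ultimately show False using len by simp
    qed
    then obtain u where u: "u \<in> U" "p ^ e \<le> count_list w u" by blast
    define n where "n = count_list w u"
    let ?w' = "replicate n u @ filter (\<lambda>v. v \<noteq> u) w"
    have mset: "mset ?w' = mset w"
      unfolding n_def by (induction w) auto
    have sub: "set w \<subseteq> carrier R" using w UR by auto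
    have "fold commutator w \<theta> = fold commutator ?w' \<theta>"
    proof (rule fold_permuted_eq[where P = "\<lambda>\<theta>. \<theta> \<in> Hom e e"])
      show "commutator r (commutator s \<eta>) = commutator s (commutator r \<eta>)"
        if "r \<in> set w" "s \<in> set w" "\<eta> \<in> Hom e e" for r s \<eta>
        using that sub by (intro commutator_commute) auto
    qed (use sub \<theta> mset commutator_Hom in auto)
    also have "\<dots> = fold commutator (filter (\<lambda>v. v \<noteq> u) w) ((commutator u ^^ n) \<theta>)"
      by simp
    also have "(commutator u ^^ n) \<theta> = zero_map"
      using commutator_nilpotent[OF \<theta>, of u n] u UR by (auto simp: n_def)
    also have "fold commutator v zero_map = zero_map" if "set v \<subseteq> carrier R" for v
      using that
    proof (induction v)
      case (Cons r v)
      then have "commutator r zero_map = zero_map"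
        by (subst commutator_eq_zero_iff) auto
      then show ?case using Cons by simp
    qed simp
    finally show "fold commutator w \<theta> = zero_map" using sub by auto
  qed
qed

end

section \<open>Direct sum decompositions\<close>

context abelian_group begin

lemma finsum_mem:
  assumes "finite A" "\<zero> \<in> W" "\<And>x y. x \<in> W \<Longrightarrow> y \<in> W \<Longrightarrow> x \<oplus> y \<in> W" "\<And>i. i \<in> A \<Longrightarrow> f i \<in> W"
    and "f \<in> A \<rightarrow> carrier G"
  shows "(\<Oplus>i\<in>A. f i) \<in> W"
  using assms(1,4,5)
proof (induction A)
  case empty
  then show ?case using assms(2) by simp
next
  case (insert x A)
  then show ?case using assms(3) by (subst finsum_insert) auto
qed

lemma finsum_additive:
  assumes "finite A" "f \<in> A \<rightarrow> carrier G" "h \<in> carrier G \<rightarrow> carrier G"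
    and add: "\<And>x y. x \<in> carrier G \<Longrightarrow> y \<in> carrier G \<Longrightarrow> h (x \<oplus> y) = h x \<oplus> h y"
  shows "h (\<Oplus>i\<in>A. f i) = (\<Oplus>i\<in>A. h (f i))"
proof -
  have hc: "h x \<in> carrier G" if "x \<in> carrier G" for x using assms(3) that by auto
  have h0: "h \<zero> = \<zero>"
    using add[of \<zero> \<zero>] hc[of \<zero>] by (simp add: add.r_cancel_one')
  show ?thesis
    using assms(1,2)
  proof (induction A)
    case empty
    then show ?case using h0 by simp
  next
    case (insert x A)
    then have "f x \<in> carrier G" "f \<in> A \<rightarrow> carrier G" by auto
    then show ?case using insert hc add by (simp add: Pi_iff)
  qed
qed

definition component :: "'i set \<Rightarrow> ('i \<Rightarrow> 'a set) \<Rightarrow> 'a \<Rightarrow> 'i \<Rightarrow> 'a"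
  where "component I N x = (THE f. f \<in> (\<Pi>\<^sub>E i \<in> I. N i) \<and> finite {i \<in> I. f i \<noteq> \<zero>} \<and>
    x = (\<Oplus>i \<in> {i \<in> I. f i \<noteq> \<zero>}. f i))"

context
  fixes I :: "'i set" and N :: "'i \<Rightarrow> 'a set"
  assumes ds: "internal_direct_sum G I N"
begin

lemma summand_subgroup: "i \<in> I \<Longrightarrow> additive_subgroup (N i) G"
  using ds by (simp add: internal_direct_sum_def)

lemma summand_subset: "i \<in> I \<Longrightarrow> N i \<subseteq> carrier G"
  using summand_subgroup additive_subgroup.a_subset by blast

lemma component_spec:
  assumes "x \<in> carrier G"
  shows "component I N x \<in> (\<Pi>\<^sub>E i \<in> I. N i)" "finite {i \<in> I. component I N x i \<noteq> \<zero>}"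
    "x = (\<Oplus>i \<in> {i \<in> I. component I N x i \<noteq> \<zero>}. component I N x i)"
proof -
  have "\<exists>!f. f \<in> (\<Pi>\<^sub>E i \<in> I. N i) \<and> finite {i \<in> I. f i \<noteq> \<zero>} \<and>
    x = (\<Oplus>i \<in> {i \<in> I. f i \<noteq> \<zero>}. f i)"
    using ds assms by (simp add: internal_direct_sum_def)
  from theI'[OF this] show "component I N x \<in> (\<Pi>\<^sub>E i \<in> I. N i)" "finite {i \<in> I. component I N x i \<noteq> \<zero>}"
    "x = (\<Oplus>i \<in> {i \<in> I. component I N x i \<noteq> \<zero>}. component I N x i)"
    unfolding component_def by blast+
qed

lemma component_mem: "x \<in> carrier G \<Longrightarrow> i \<in> I \<Longrightarrow> component I N x i \<in> N i"
  using component_spec(1) by (meson PiE_mem)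

lemma component_closed: "x \<in> carrier G \<Longrightarrow> i \<in> I \<Longrightarrow> component I N x i \<in> carrier G"
  using component_mem summand_subset by blast

lemma component_sum:
  assumes x: "x \<in> carrier G" and A: "finite A" "A \<subseteq> I" "\<And>i. i \<in> I - A \<Longrightarrow> component I N x i = \<zero>"
  shows "(\<Oplus>i\<in>A. component I N x i) = x"
proof -
  have "(\<Oplus>i\<in>A. component I N x i) = (\<Oplus>i \<in> {i \<in> I. component I N x i \<noteq> \<zero>}. component I N x i)"
    using A x component_closed by (intro add.finprod_mono_neutral_cong_right) auto
  then show ?thesis using component_spec(3)[OF x] by simp
qed

lemma component_eqI:
  assumes x: "x \<in> carrier G" and f: "\<And>i. i \<in> I \<Longrightarrow> f i \<in> N i"
    and A: "finite A" "A \<subseteq> I" "\<And>i. i \<in> I - A \<Longrightarrow> f i = \<zero>" and sum: "x = (\<Oplus>i\<in>A. f i)" and i: "i \<in> I"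
  shows "component I N x i = f i"
proof -
  let ?f = "restrict f I"
  have "\<exists>!f. f \<in> (\<Pi>\<^sub>E i \<in> I. N i) \<and> finite {i \<in> I. f i \<noteq> \<zero>} \<and>
    x = (\<Oplus>i \<in> {i \<in> I. f i \<noteq> \<zero>}. f i)"
    using ds x by (simp add: internal_direct_sum_def)
  moreover have "?f \<in> (\<Pi>\<^sub>E i \<in> I. N i)" using f by auto
  moreover have supp: "{i \<in> I. ?f i \<noteq> \<zero>} \<subseteq> A" using A by auto
  moreover have "finite {i \<in> I. ?f i \<noteq> \<zero>}" using supp A(1) by (rule finite_subset)
  moreover have "x = (\<Oplus>i \<in> {i \<in> I. ?f i \<noteq> \<zero>}. ?f i)"
    unfolding sum using A f summand_subset
    by (intro add.finprod_mono_neutral_cong_right) (auto simp: Pi_iff subset_iff)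
  ultimately have "component I N x = ?f"
    using component_spec[OF x] by blast
  then show ?thesis using i by simp
qed

lemma zero_summand: "i \<in> I \<Longrightarrow> \<zero> \<in> N i"
  using summand_subgroup additive_subgroup.zero_closed by blast

lemma component_add:
  assumes x: "x \<in> carrier G" and y: "y \<in> carrier G" and i: "i \<in> I"
  shows "component I N (x \<oplus> y) i = component I N x i \<oplus> component I N y i"
proof -
  let ?A = "{i \<in> I. component I N x i \<noteq> \<zero>} \<union> {i \<in> I. component I N y i \<noteq> \<zero>}"
  have fin: "finite ?A" using component_spec(2)[OF x] component_spec(2)[OF y] by (rule finite_UnI)
  have sx: "(\<Oplus>i\<in>?A. component I N x i) = x"
    by (rule component_sum[OF x fin]) auto
  have sy: "(\<Oplus>i\<in>?A. component I N y i) = y"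
    by (rule component_sum[OF y fin]) auto
  show ?thesis
  proof (rule component_eqI[where A = ?A])
    have "(\<Oplus>i\<in>?A. component I N x i \<oplus> component I N y i)
        = (\<Oplus>i\<in>?A. component I N x i) \<oplus> (\<Oplus>i\<in>?A. component I N y i)"
      by (rule finsum_addf) (auto intro: component_closed x y)
    also have "\<dots> = x \<oplus> y"
      by (simp only: sx sy)
    finally show "x \<oplus> y = (\<Oplus>i\<in>?A. component I N x i \<oplus> component I N y i)" by simp
    show "component I N x j \<oplus> component I N y j \<in> N j" if "j \<in> I" for j
      using summand_subgroup[OF that] component_mem[OF x that] component_mem[OF y that]
      by (rule additive_subgroup.a_closed)
    show "x \<oplus> y \<in> carrier G" using x y by simp
    show "finite ?A" by (rule fin)
    show "component I N x j \<oplus> component I N y j = \<zero>" if "j \<in> I - ?A" for j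
      using that by simp
  qed (use i in auto)
qed

text \<open>An additive map that preserves every summand acts coordinatewise.  With multiplication by
\<open>r ^ (p ^ e)\<close> as the map, this makes the projections onto submodules of \<open>\<^sup>eR\<close> linear.\<close>
lemma component_additive:
  assumes x: "x \<in> carrier G" and i: "i \<in> I"
    and h: "h \<in> carrier G \<rightarrow> carrier G" "\<And>x y. x \<in> carrier G \<Longrightarrow> y \<in> carrier G \<Longrightarrow> h (x \<oplus> y) = h x \<oplus> h y"
    and stable: "\<And>i x. i \<in> I \<Longrightarrow> x \<in> N i \<Longrightarrow> h x \<in> N i"
  shows "component I N (h x) i = h (component I N x i)"
proof -
  let ?A = "{i \<in> I. component I N x i \<noteq> \<zero>}"
  have h0: "h \<zero> = \<zero>"
    using h(2)[of \<zero> \<zero>] funcset_mem[OF h(1), of \<zero>] by (simp add: add.r_cancel_one')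
  show ?thesis
  proof (rule component_eqI[where A = ?A])
    have "h x = h (\<Oplus>i\<in>?A. component I N x i)" using component_spec(3)[OF x] by simp
    also have "\<dots> = (\<Oplus>i\<in>?A. h (component I N x i))"
      using component_spec(2)[OF x] x component_closed h by (intro finsum_additive) auto
    finally show "h x = (\<Oplus>i\<in>?A. h (component I N x i))" .
  qed (use x h h0 stable component_mem component_spec(2) i in auto)
qed

lemma component_of_summand:
  assumes j: "j \<in> I" and x: "x \<in> N j" and i: "i \<in> I"
  shows "component I N x i = (if i = j then x else \<zero>)"
proof (rule component_eqI[where A = "{j}"])
  have "x \<in> carrier G" using summand_subset j x by blast
  then show "x \<in> carrier G" "x = (\<Oplus>i\<in>{j}. if i = j then x else \<zero>)"
    by auto
qed (use assms zero_summand in auto)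

end
end

section \<open>Nonzerodivisors in Noetherian rings\<close>

context cring begin

lemma cring_idealI:
  assumes "I \<subseteq> carrier R" "\<zero> \<in> I" "\<And>x y. x \<in> I \<Longrightarrow> y \<in> I \<Longrightarrow> x \<oplus> y \<in> I"
    "\<And>r x. r \<in> carrier R \<Longrightarrow> x \<in> I \<Longrightarrow> r \<otimes> x \<in> I"
  shows "ideal I R"
proof (rule idealI[OF ring_axioms])
  show "subgroup I (add_monoid R)"
  proof (rule add.subgroupI)
    show "\<ominus> x \<in> I" if "x \<in> I" for x
      using assms(4)[of "\<ominus> \<one>" x] assms(1) that by (auto simp: l_minus)
  qed (use assms in auto)
  show "x \<otimes> a \<in> I" "a \<otimes> x \<in> I" if "a \<in> I" "x \<in> carrier R" for a x
    using assms(4)[OF that(2,1)] assms(1) that m_comm[of a x] by auto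
qed

lemma exists_maximal_ideal_in:
  assumes noeth: "noetherian_ring R" and ne: "F \<noteq> {}" and ideals: "\<And>I. I \<in> F \<Longrightarrow> ideal I R"
  obtains Q where "Q \<in> F" "\<And>I. I \<in> F \<Longrightarrow> Q \<subseteq> I \<Longrightarrow> I = Q"
proof -
  have "\<exists>Q \<in> F. \<forall>I \<in> F. Q \<subseteq> I \<longrightarrow> I = Q"
  proof (rule subset_Zorn_nonempty[OF ne])
    fix C assume C: "C \<noteq> {}" "subset.chain F C"
    then have "subset.chain {I. ideal I R} C"
      using ideals by (auto simp: pred_on.chain_def)
    then have "\<Union>C \<in> C" by (rule noetherian_ring.ideal_chain_is_trivial[OF noeth C(1)])
    then show "\<Union>C \<in> F" using C by (auto simp: pred_on.chain_def)
  qed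
  then show ?thesis using that by blast
qed

text \<open>If a nonzerodivisor \<open>c\<close> were in the minimal prime \<open>P\<close>, then the multiplicative set \<open>S\<close> generated by
\<open>c\<close> and the complement of \<open>P\<close> would not contain 0.  An ideal maximal among those disjoint from \<open>S\<close>
is prime, and it would be strictly smaller than \<open>P\<close>.\<close>
lemma not_in_minimal_prime:
  assumes noeth: "noetherian_ring R" and c: "c \<in> carrier R"
    and nzd: "\<And>y. y \<in> carrier R \<Longrightarrow> c \<otimes> y = \<zero> \<Longrightarrow> y = \<zero>"
    and P: "minimal_prime P R"
  shows "c \<notin> P"
proof
  assume cP: "c \<in> P"
  interpret P: primeideal P R using P by (simp add: minimal_prime_def)
  define S where "S = {s \<otimes> c [^] n | s n. s \<in> carrier R - P \<and> n \<in> (UNIV :: nat set)}"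
  have one_P: "\<one> \<notin> P" using P.I_notcarr P.one_imp_carrier by blast
  have S_mult: "x \<otimes> y \<in> S" if xy: "x \<in> S" "y \<in> S" for x y
  proof -
    obtain s m t n where x: "x = s \<otimes> c [^] (m::nat)" "s \<in> carrier R" "s \<notin> P"
      and y: "y = t \<otimes> c [^] (n::nat)" "t \<in> carrier R" "t \<notin> P"
      using xy by (auto simp: S_def)
    have "x \<otimes> y = (s \<otimes> t) \<otimes> c [^] (m + n)"
      using x y c by (simp add: nat_pow_mult[symmetric] m_ac)
    moreover have "s \<otimes> t \<notin> P" using P.I_prime x y by blast
    ultimately show ?thesis using x y unfolding S_def by blast
  qed
  have sub_S: "s \<in> S" if "s \<in> carrier R" "s \<notin> P" for s
    using that unfolding S_def by (auto intro!: exI[of _ s] exI[of _ "0::nat"])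
  have c_S: "c \<in> S"
    using c one_P unfolding S_def by (auto intro!: exI[of _ \<one>] exI[of _ "1::nat"])
  have zero_S: "\<zero> \<notin> S"
  proof
    assume "\<zero> \<in> S"
    then obtain s n where s: "s \<in> carrier R" "s \<notin> P" and z: "s \<otimes> c [^] (n::nat) = \<zero>"
      by (auto simp: S_def)
    have "s \<otimes> c [^] (n::nat) = \<zero> \<Longrightarrow> s = \<zero>" for n
    proof (induction n)
      case (Suc n)
      have "s \<otimes> c [^] Suc n = c \<otimes> (s \<otimes> c [^] n)" using s c by (simp add: m_ac)
      then show ?case using Suc nzd[of "s \<otimes> c [^] n"] s c by simp
    qed (use s in simp)
    with z have "s = \<zero>" by blast
    then show False using s by auto
  qed
  let ?F = "{I. ideal I R \<and> I \<inter> S = {}}"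
  have "?F \<noteq> {}" using zeroideal zero_S by auto
  then obtain Q where QF: "Q \<in> ?F" and max: "\<And>I. I \<in> ?F \<Longrightarrow> Q \<subseteq> I \<Longrightarrow> I = Q"
    by (rule exists_maximal_ideal_in[OF noeth]) auto
  interpret Q: ideal Q R using QF by simp
  have QS: "Q \<inter> S = {}" using QF by simp
  have meets: "\<exists>q \<in> Q. \<exists>r \<in> carrier R. q \<oplus> r \<otimes> a \<in> S" if a: "a \<in> carrier R" "a \<notin> Q" for a
  proof (rule ccontr)
    let ?J = "{q \<oplus> r \<otimes> a | q r. q \<in> Q \<and> r \<in> carrier R}"
    assume "\<not> ?thesis"
    then have "?J \<inter> S = {}" by blast
    moreover have "ideal ?J R"
    proof (rule cring_idealI)
      show "?J \<subseteq> carrier R" using a Q.Icarr by auto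
      show "\<zero> \<in> ?J" using a by (auto intro!: exI[of _ \<zero>])
    next
      fix x y assume "x \<in> ?J" "y \<in> ?J"
      then obtain q r q' r' where e: "x = q \<oplus> r \<otimes> a" "q \<in> Q" "r \<in> carrier R"
        "y = q' \<oplus> r' \<otimes> a" "q' \<in> Q" "r' \<in> carrier R" by blast
      then have "x \<oplus> y = (q \<oplus> q') \<oplus> (r \<oplus> r') \<otimes> a"
        using a Q.Icarr by (simp add: l_distr a_ac)
      then show "x \<oplus> y \<in> ?J" using e by blast
    next
      fix s x assume s: "s \<in> carrier R" and "x \<in> ?J"
      then obtain q r where e: "x = q \<oplus> r \<otimes> a" "q \<in> Q" "r \<in> carrier R" by blast
      then have "s \<otimes> x = s \<otimes> q \<oplus> (s \<otimes> r) \<otimes> a"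
        using a s Q.Icarr by (simp add: r_distr m_assoc)
      then show "s \<otimes> x \<in> ?J" using e s Q.I_l_closed by blast
    qed
    moreover have "Q \<subseteq> ?J"
    proof
      fix q assume q: "q \<in> Q"
      then have "q = q \<oplus> \<zero> \<otimes> a" using a Q.Icarr by simp
      then show "q \<in> ?J" using q by blast
    qed
    ultimately have "?J = Q" by (intro max CollectI conjI)
    moreover have "a = \<zero> \<oplus> \<one> \<otimes> a" using a by simp
    then have "a \<in> ?J" using Q.zero_closed by blast
    ultimately show False using a by blast
  qed
  have "primeideal Q R"
  proof (rule primeidealI[OF Q.is_ideal is_cring])
    show "carrier R \<noteq> Q" using QS sub_S[OF one_closed one_P] by auto
    fix a b assume a: "a \<in> carrier R" and b: "b \<in> carrier R" and ab: "a \<otimes> b \<in> Q"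
    show "a \<in> Q \<or> b \<in> Q"
    proof (rule ccontr)
      assume "\<not> ?thesis"
      then obtain q r q' r' where *: "q \<in> Q" "r \<in> carrier R" "q \<oplus> r \<otimes> a \<in> S"
        "q' \<in> Q" "r' \<in> carrier R" "q' \<oplus> r' \<otimes> b \<in> S"
        using meets[of a] meets[of b] a b by blast
      have "(q \<oplus> r \<otimes> a) \<otimes> (q' \<oplus> r' \<otimes> b) =
          q \<otimes> (q' \<oplus> r' \<otimes> b) \<oplus> ((r \<otimes> a) \<otimes> q' \<oplus> (r \<otimes> r') \<otimes> (a \<otimes> b))"
        using * a b Q.Icarr[of q] Q.Icarr[of q'] by algebra
      moreover have "q \<otimes> (q' \<oplus> r' \<otimes> b) \<in> Q" "(r \<otimes> a) \<otimes> q' \<in> Q" "(r \<otimes> r') \<otimes> (a \<otimes> b) \<in> Q"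
        using * a b ab Q.Icarr by (simp_all add: Q.I_l_closed Q.I_r_closed)
      then have "q \<otimes> (q' \<oplus> r' \<otimes> b) \<oplus> ((r \<otimes> a) \<otimes> q' \<oplus> (r \<otimes> r') \<otimes> (a \<otimes> b)) \<in> Q"
        by (intro Q.a_closed)
      ultimately show False using S_mult[OF *(3,6)] QS by auto
    qed
  qed
  moreover have "Q \<subseteq> P" using sub_S QS Q.Icarr by blast
  ultimately have "Q = P" using P by (simp add: minimal_prime_def)
  then show False using cP c_S QS by blast
qed

text \<open>Every \<open>x\<close> can be completed by an element \<open>y\<close> of its annihilator to a nonzerodivisor \<open>x + y\<close>: take
\<open>y\<close> with smallest possible annihilator.  If some \<open>z \<noteq> 0\<close> in the annihilator of \<open>x\<close> killed \<open>y\<close>, then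
\<open>y + z\<close> would have a smaller one, because in a reduced ring \<open>y z = 0\<close> makes the annihilator of
\<open>y + z\<close> the intersection of those of \<open>y\<close> and \<open>z\<close>.  To apply the
ascending chain condition, smallness of the annihilator is expressed by maximality of the double
annihilator \<open>A y\<close>.\<close>
lemma nonzerodivisor_from_zero_divisors:
  assumes noeth: "noetherian_ring R" and red: "reduced_ring R" and x: "x \<in> carrier R"
  obtains y where "y \<in> carrier R" "x \<otimes> y = \<zero>"
    "\<And>z. z \<in> carrier R \<Longrightarrow> x \<otimes> z = \<zero> \<Longrightarrow> y \<otimes> z = \<zero> \<Longrightarrow> z = \<zero>"
proof -
  have sq: "z = \<zero>" if "z \<in> carrier R" "z \<otimes> z = \<zero>" for z
    using red that unfolding reduced_ring_def by (metis nat_pow_0 nat_pow_Suc l_one numeral_2_eq_2)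
  define A where "A y = {w \<in> carrier R. \<forall>z \<in> carrier R. y \<otimes> z = \<zero> \<longrightarrow> w \<otimes> z = \<zero>}" for y
  let ?F = "A ` {y \<in> carrier R. x \<otimes> y = \<zero>}"
  have ideal: "ideal (A y) R" if "y \<in> carrier R" for y
    unfolding A_def by (rule cring_idealI) (auto simp: l_distr m_assoc)
  have "\<zero> \<in> {y \<in> carrier R. x \<otimes> y = \<zero>}" using x by simp
  then have "?F \<noteq> {}" by blast
  then obtain Q where QF: "Q \<in> ?F" and max: "\<And>I. I \<in> ?F \<Longrightarrow> Q \<subseteq> I \<Longrightarrow> I = Q"
    by (rule exists_maximal_ideal_in[OF noeth]) (use ideal in auto)
  then obtain y where y: "y \<in> carrier R" "x \<otimes> y = \<zero>" and Q: "Q = A y" by blast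
  have "z = \<zero>" if z: "z \<in> carrier R" "x \<otimes> z = \<zero>" "y \<otimes> z = \<zero>" for z
  proof -
    have both: "y \<otimes> w = \<zero> \<and> z \<otimes> w = \<zero>" if w: "w \<in> carrier R" "(y \<oplus> z) \<otimes> w = \<zero>" for w
    proof -
      have "(z \<otimes> w) \<otimes> (z \<otimes> w) = (z \<otimes> w) \<otimes> ((y \<oplus> z) \<otimes> w) \<ominus> (y \<otimes> z) \<otimes> (w \<otimes> w)"
        using w(1) y(1) z(1) by algebra
      then have "(z \<otimes> w) \<otimes> (z \<otimes> w) = \<zero>" using w y z by (simp add: minus_eq)
      then have zw: "z \<otimes> w = \<zero>" using sq[of "z \<otimes> w"] w(1) z(1) by blast
      have "y \<otimes> w = (y \<oplus> z) \<otimes> w"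
        using w(1) y(1) z(1) zw by (simp add: l_distr)
      then show ?thesis using w(2) zw by simp
    qed
    have "A (y \<oplus> z) = A y"
    proof (rule max[unfolded Q])
      show "A (y \<oplus> z) \<in> ?F" using x y z by (auto simp: r_distr)
      show "A y \<subseteq> A (y \<oplus> z)" using both by (auto simp: A_def)
    qed
    moreover have "z \<in> A (y \<oplus> z)" using both z by (auto simp: A_def)
    ultimately have "z \<in> A y" by simp
    then have "z \<otimes> z = \<zero>" using z by (simp add: A_def)
    then show ?thesis using sq[of z] z(1) by blast
  qed
  then show ?thesis using that y by blast
qed

end

section \<open>Idempotents of local and graded rings\<close>

text \<open>One of the complementary idempotents \<open>e\<close> and \<open>1 - e\<close> lies outside the maximal ideal, so it is
a unit, and a unit idempotent is 1.\<close>
lemma (in cring) local_idempotent: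
  assumes noeth: "noetherian_ring R" and m: "unique_maximal_ideal m R"
    and e: "e \<in> carrier R" "e \<otimes> e = e"
  shows "e = \<zero> \<or> e = \<one>"
proof -
  interpret m: maximalideal m R using m by (simp add: unique_maximal_ideal_def)
  have unit: "\<exists>y \<in> carrier R. y \<otimes> x = \<one>" if x: "x \<in> carrier R" "x \<notin> m" for x
  proof (rule ccontr)
    assume no: "\<not> ?thesis"
    let ?F = "{I. ideal I R \<and> x \<in> I \<and> \<one> \<notin> I}"
    have "PIdl x \<in> ?F"
      using no x by (auto simp: cgenideal_ideal cgenideal_self) (auto simp: cgenideal_def)
    then have "?F \<noteq> {}" by blast
    then obtain Q where QF: "Q \<in> ?F" and max: "\<And>I. I \<in> ?F \<Longrightarrow> Q \<subseteq> I \<Longrightarrow> I = Q"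
      by (rule exists_maximal_ideal_in[OF noeth]) auto
    have "maximalideal Q R"
    proof (rule maximalidealI)
      show "ideal Q R" "carrier R \<noteq> Q" using QF by auto
      show "J = Q \<or> J = carrier R" if "ideal J R" "Q \<subseteq> J" for J
        using that QF max[of J] ideal.one_imp_carrier[of J R] by blast
    qed
    then have "Q = m" using m by (simp add: unique_maximal_ideal_def)
    then show False using QF x by simp
  qed
  have cancel: "f = \<one>" if f: "f \<in> carrier R" "f \<otimes> f = f" "f \<notin> m" for f
  proof -
    obtain y where y: "y \<in> carrier R" "y \<otimes> f = \<one>" using unit f by blast
    have "f = (y \<otimes> f) \<otimes> f" using y f by simp
    also have "\<dots> = y \<otimes> (f \<otimes> f)" using y f by (intro m_assoc)
    finally show ?thesis using f y by simp
  qed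
  show ?thesis
  proof (cases "e \<in> m")
    case False
    then show ?thesis using cancel e by blast
  next
    case True
    have "\<one> \<ominus> e \<notin> m"
    proof
      assume "\<one> \<ominus> e \<in> m"
      then have "(\<one> \<ominus> e) \<oplus> e \<in> m" using True by simp
      moreover have "(\<one> \<ominus> e) \<oplus> e = \<one>" using e(1) by algebra
      ultimately show False using m.I_notcarr m.one_imp_carrier by auto
    qed
    moreover have "(\<one> \<ominus> e) \<otimes> (\<one> \<ominus> e) = (\<one> \<ominus> e) \<ominus> (e \<ominus> e \<otimes> e)" using e(1) by algebra
    then have "(\<one> \<ominus> e) \<otimes> (\<one> \<ominus> e) = \<one> \<ominus> e" using e by (simp add: minus_eq r_neg)
    ultimately have "\<one> \<ominus> e = \<one>" using cancel e by simp
    moreover have "e = \<one> \<ominus> (\<one> \<ominus> e)" using e(1) by algebra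
    ultimately show ?thesis by (simp add: minus_eq r_neg)
  qed
qed

text \<open>Filter \<open>R\<close> by the ideals \<open>V n\<close> of elements without components of degree below \<open>n\<close>.  The degree 0
part of an idempotent \<open>e\<close> is an idempotent of the field \<open>G 0\<close>, so \<open>e\<close> or \<open>1 - e\<close> lies in \<open>V 1\<close>.  An
idempotent in \<open>V 1\<close> equals all its powers, hence lies in every \<open>V n\<close>, and vanishes.\<close>
lemma (in cring) graded_idempotent:
  assumes G: "graded_ring R G" and G0: "subfield (G 0) R"
    and e: "e \<in> carrier R" "e \<otimes> e = e"
  shows "e = \<zero> \<or> e = \<one>"
proof -
  have ds: "internal_direct_sum R UNIV G" using G by (simp add: graded_ring_def)
  have Gmult: "x \<otimes> y \<in> G (i + j)" if "x \<in> G i" "y \<in> G j" for i j x y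
    using G that by (simp add: graded_ring_def)
  let ?c = "component UNIV G"
  have cc: "?c x i \<in> carrier R" if "x \<in> carrier R" for x i using component_closed[OF ds that] by simp
  have cadd: "?c (x \<oplus> y) i = ?c x i \<oplus> ?c y i" if "x \<in> carrier R" "y \<in> carrier R" for x y i
    using component_add[OF ds that] by simp
  define V where "V n = {x \<in> carrier R. \<forall>i<n. ?c x i = \<zero>}" for n
  have Vc: "V n \<subseteq> carrier R" for n by (auto simp: V_def)
  have Vadd: "x \<oplus> y \<in> V n" if "x \<in> V n" "y \<in> V n" for x y n
    using that by (auto simp: V_def cadd)
  have czero: "?c \<zero> i = \<zero>" for i
    using component_of_summand[OF ds _ zero_summand[OF ds], of 0 i] by auto
  have Vzero: "\<zero> \<in> V n" for n by (simp add: V_def czero)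
  have GV: "x \<in> V n" if "x \<in> G j" "n \<le> j" for x j n
    using that component_of_summand[OF ds _ that(1)] summand_subset[OF ds, of j] by (auto simp: V_def)
  have sum: "(\<Oplus>i\<in>{i. ?c x i \<noteq> \<zero>}. ?c x i) = x" and fin: "finite {i. ?c x i \<noteq> \<zero>}"
    if "x \<in> carrier R" for x
    using component_spec[OF ds that] by simp_all
  have Gc: "x \<in> carrier R" if "x \<in> G i" for x i using summand_subset[OF ds, of i] that by auto
  have GVmult: "x \<otimes> y \<in> V (a + b)" if x: "x \<in> G i" "a \<le> i" and y: "y \<in> V b" for x y i a b
  proof -
    have yc: "y \<in> carrier R" using y Vc by blast
    have "x \<otimes> y = (\<Oplus>j\<in>{j. ?c y j \<noteq> \<zero>}. x \<otimes> ?c y j)"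
      using finsum_rdistr[OF fin[OF yc] Gc[OF x(1)], of "?c y"] sum[OF yc] cc[OF yc] by simp
    also have "\<dots> \<in> V (a + b)"
    proof (rule finsum_mem[OF fin[OF yc] Vzero Vadd])
      fix j assume "j \<in> {j. ?c y j \<noteq> \<zero>}"
      then have "b \<le> j" using y by (auto simp: V_def not_less[symmetric])
      then show "x \<otimes> ?c y j \<in> V (a + b)"
        using x Gmult[OF x(1) component_mem[OF ds yc, of j]] by (intro GV) auto
    qed (use Gc[OF x(1)] cc[OF yc] in auto)
    finally show ?thesis .
  qed
  have Vmult: "x \<otimes> y \<in> V (a + b)" if x: "x \<in> V a" and y: "y \<in> V b" for x y a b
  proof -
    have xc: "x \<in> carrier R" and yc: "y \<in> carrier R" using x y Vc by blast+
    have "x \<otimes> y = (\<Oplus>i\<in>{i. ?c x i \<noteq> \<zero>}. ?c x i \<otimes> y)"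
      using finsum_ldistr[OF fin[OF xc] yc, of "?c x"] sum[OF xc] cc[OF xc] by simp
    also have "\<dots> \<in> V (a + b)"
    proof (rule finsum_mem[OF fin[OF xc] Vzero Vadd])
      fix i assume "i \<in> {i. ?c x i \<noteq> \<zero>}"
      then have "a \<le> i" using x by (auto simp: V_def not_less[symmetric])
      then show "?c x i \<otimes> y \<in> V (a + b)"
        using component_mem[OF ds xc, of i] y by (intro GVmult) auto
    qed (use yc cc[OF xc] in auto)
    finally show ?thesis .
  qed
  have idem0: "f = \<zero>" if f: "f \<in> V 1" "f \<otimes> f = f" for f
  proof -
    have "f \<in> V (Suc n)" for n
    proof (induction n)
      case (Suc n)
      then show ?case using Vmult[OF f(1) Suc] f(2) by simp
    qed (use f in simp)
    then have "?c f i = \<zero>" for i by (auto simp: V_def)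
    moreover have "f \<in> carrier R" using f Vc by blast
    ultimately show ?thesis using sum[of f] by simp
  qed
  interpret K: subfield "G 0" R by fact
  let ?a = "?c e 0" and ?b = "e \<ominus> ?c e 0"
  have a: "?a \<in> G 0" using component_mem[OF ds e(1), of 0] by simp
  have ac: "?a \<in> carrier R" using cc e by simp
  have neg_a: "\<ominus> ?a \<in> G 0" using a K.subring_axioms by (simp add: subringE(5))
  have b: "?b \<in> V 1"
    using e ac component_of_summand[OF ds _ a, of 0] component_of_summand[OF ds _ neg_a, of 0]
    by (simp add: V_def minus_eq cadd r_neg)
  have bc: "?b \<in> carrier R" using b Vc by blast
  have V_sub: "\<ominus> x \<in> V n" if "x \<in> V n" for x n
  proof -
    have xc: "\<ominus> x \<in> carrier R" "x \<in> carrier R" using that Vc by auto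
    have "?c (\<ominus> x) i = \<zero>" if i: "i < n" for i
    proof -
      have "?c x i = \<zero>" using \<open>x \<in> V n\<close> i by (simp add: V_def)
      then have "?c (\<ominus> x) i = ?c (\<ominus> x) i \<oplus> ?c x i"
        using cc[OF xc(1), of i] by simp
      also have "\<dots> = ?c (\<ominus> x \<oplus> x) i" using cadd[OF xc] by simp
      also have "\<ominus> x \<oplus> x = \<zero>" using xc by (simp add: l_neg)
      finally show ?thesis by (simp only: czero)
    qed
    then show ?thesis using xc by (simp add: V_def)
  qed
  have GV1: "x \<otimes> y \<in> V 1" if "x \<in> G 0" "y \<in> V 1" for x y
    using GVmult[of x 0 0 y 1] that by simp
  have bb: "?b \<otimes> ?b \<in> V 1" using Vmult[OF b b] by (auto simp: V_def)
  \<comment> \<open>\<open>e * e - e = 0\<close> shows that \<open>?a * ?a - ?a\<close> lies in \<open>V 1\<close>; being of degree 0, it vanishes\<close>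
  let ?d = "?a \<otimes> ?a \<ominus> ?a"
  have "?d = ?b \<oplus> \<ominus> (?a \<otimes> ?b \<oplus> ?a \<otimes> ?b \<oplus> ?b \<otimes> ?b) \<oplus> (e \<otimes> e \<ominus> e)"
    using ac e(1) by algebra
  also have "e \<otimes> e \<ominus> e = \<zero>" using e by (simp add: minus_eq r_neg)
  also have "?b \<oplus> \<ominus> (?a \<otimes> ?b \<oplus> ?a \<otimes> ?b \<oplus> ?b \<otimes> ?b) \<oplus> \<zero> \<in> V 1"
    by (intro Vadd V_sub Vzero b bb GV1[OF a b])
  finally have "?c ?d 0 = \<zero>" by (simp add: V_def)
  moreover have "?d \<in> G 0"
    using a neg_a K.subring_axioms by (simp add: minus_eq subringE(6,7))
  ultimately have d: "?d = \<zero>" using component_of_summand[OF ds _ \<open>?d \<in> G 0\<close>, of 0] by simp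
  have "?a \<otimes> (?a \<ominus> \<one>) = ?d" using ac by algebra
  moreover have "?a \<ominus> \<one> \<in> G 0"
    using a K.subring_axioms by (simp add: minus_eq subringE(3,5,7))
  ultimately have "?a = \<zero> \<or> ?a \<ominus> \<one> = \<zero>"
    using K.subintegral a d by metis
  then show ?thesis
  proof
    assume "?a = \<zero>"
    then have "e \<in> V 1" using b e by (simp add: minus_eq)
    then show ?thesis using idem0 e by blast
  next
    assume "?a \<ominus> \<one> = \<zero>"
    then have a1: "?a = \<one>" using ac by simp
    let ?f = "\<one> \<ominus> e"
    have "?f = \<ominus> ?b" using a1 e(1) by (simp, algebra)
    then have "?f \<in> V 1" using V_sub[OF b] by simp
    moreover have "?f \<otimes> ?f = ?f \<oplus> (e \<otimes> e \<ominus> e)" using e(1) by algebra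
    then have "?f \<otimes> ?f = ?f" using e by (simp add: minus_eq r_neg)
    ultimately have "?f = \<zero>" by (rule idem0)
    then show ?thesis using e by simp
  qed
qed

section \<open>Strong F-regularity\<close>

lemma finsum_with_action: "finsum (with_action R act) = finsum R"
  by (simp add: fun_eq_iff with_action_def finsum_def finprod_def)

context prime_char_ring begin

lemma frob_generates_Suc:
  assumes U: "frob_generates e U" and V: "frob_generates 1 V"
  shows "frob_generates (Suc e) ((\<lambda>(u, v). u [^] p \<otimes> v) ` (U \<times> V))"
proof -
  let ?UV = "(\<lambda>(u, v). u [^] p \<otimes> v) ` (U \<times> V)"
  have UR: "U \<subseteq> carrier R" and VR: "V \<subseteq> carrier R"
    using U V by (simp_all add: frob_generates_def)
  have "carrier R \<subseteq> W"
    if UV: "?UV \<subseteq> W" and zero: "\<zero> \<in> W" and add: "\<forall>x \<in> W. \<forall>y \<in> W. x \<oplus> y \<in> W"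
      and smult: "\<forall>r \<in> carrier R. \<forall>x \<in> W. r [^] (p ^ Suc e) \<otimes> x \<in> W" for W
  proof -
    have uv: "r [^] p \<otimes> v \<in> W" if v: "v \<in> V" and r: "r \<in> carrier R" for r v
    proof -
      have vR: "v \<in> carrier R" using v VR by blast
      let ?W = "{r \<in> carrier R. r [^] p \<otimes> v \<in> W}"
      have "r \<in> ?W"
      proof (rule frob_generatesD[OF U _ _ _ _ r])
        show "U \<subseteq> ?W" using UV UR v by auto
        show "\<zero> \<in> ?W" using zero vR p_gt_0 by (simp add: nat_pow_zero)
        show "x \<oplus> y \<in> ?W" if "x \<in> ?W" "y \<in> ?W" for x y
          using that add vR frobenius_add[of x y 1] by (simp add: l_distr)
        show "s [^] (p ^ e) \<otimes> x \<in> ?W" if "s \<in> carrier R" "x \<in> ?W" for s x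
        proof -
          have "(s [^] (p ^ e) \<otimes> x) [^] p \<otimes> v = s [^] (p ^ Suc e) \<otimes> (x [^] p \<otimes> v)"
            using that vR by (simp add: nat_pow_distrib nat_pow_pow m_assoc mult.commute)
          then show ?thesis using that smult by simp
        qed
      qed
      then show ?thesis by simp
    qed
    let ?W = "{x \<in> carrier R. \<forall>r \<in> carrier R. r [^] p \<otimes> x \<in> W}"
    show "carrier R \<subseteq> W"
    proof
      fix x assume x: "x \<in> carrier R"
      have "x \<in> ?W"
      proof (rule frob_generatesD[OF V _ _ _ _ x])
        show "V \<subseteq> ?W" using uv VR by auto
        show "\<zero> \<in> ?W" using zero by simp
        show "x \<oplus> y \<in> ?W" if "x \<in> ?W" "y \<in> ?W" for x y
          using that add by (simp add: r_distr)
        show "s [^] (p ^ 1) \<otimes> x \<in> ?W" if "s \<in> carrier R" "x \<in> ?W" for s x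
        proof -
          have "r [^] p \<otimes> (s [^] p \<otimes> x) \<in> W" if r: "r \<in> carrier R" for r
          proof -
            have "r [^] p \<otimes> (s [^] p \<otimes> x) = (r \<otimes> s) [^] p \<otimes> x"
              using \<open>s \<in> carrier R\<close> \<open>x \<in> ?W\<close> r by (simp add: nat_pow_distrib m_assoc)
            then show ?thesis using \<open>s \<in> carrier R\<close> \<open>x \<in> ?W\<close> r by simp
          qed
          then show ?thesis using that by simp
        qed
      qed
      then have "\<one> [^] p \<otimes> x \<in> W" by blast
      then show "x \<in> W" using x by simp
    qed
  qed
  moreover have "?UV \<subseteq> carrier R" using UR VR by auto
  ultimately show ?thesis unfolding frob_generates_def by blast
qed

text \<open>Strong F-regularity includes finite generation of \<open>R\<close> over its \<open>p\<close>-th powers; iterating gives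
finite generation over \<open>p ^ e\<close>-th powers for every \<open>e\<close>.\<close>
lemma F_finite_generators:
  assumes "strongly_F_regular p R"
  shows "\<exists>U. finite U \<and> frob_generates e U"
proof (induction e)
  case 0
  have "frob_generates 0 {\<one>}"
    unfolding frob_generates_def
  proof (intro conjI allI impI subsetI)
    fix W x assume "{\<one>} \<subseteq> W \<and> \<zero> \<in> W \<and> (\<forall>x\<in>W. \<forall>y\<in>W. x \<oplus> y \<in> W) \<and>
      (\<forall>r\<in>carrier R. \<forall>x\<in>W. r [^] p ^ 0 \<otimes> x \<in> W)" and x: "x \<in> carrier R"
    then have "x [^] p ^ 0 \<otimes> \<one> \<in> W" by blast
    then show "x \<in> W" using x by simp
  qed simp
  then show ?case by blast
next
  case (Suc e)
  have "fg_module (R\<lparr>carrier := pth_powers p R (carrier R)\<rparr>) (regular_module R)"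
    using assms by (simp add: strongly_F_regular_def)
  then obtain S where S: "finite S" "S \<subseteq> carrier R" and span: "\<And>x. x \<in> carrier R \<Longrightarrow>
    \<exists>a \<in> S \<rightarrow> pth_powers p R (carrier R). x = (\<Oplus>s \<in> S. a s \<otimes> s)"
    by (auto simp: fg_module_def regular_module_def finsum_with_action) (auto simp: with_action_def)
  have "frob_generates 1 S"
    unfolding frob_generates_def
  proof (intro conjI allI impI subsetI)
    fix W x assume "S \<subseteq> W \<and> \<zero> \<in> W \<and> (\<forall>x\<in>W. \<forall>y\<in>W. x \<oplus> y \<in> W) \<and>
      (\<forall>r\<in>carrier R. \<forall>x\<in>W. r [^] p ^ 1 \<otimes> x \<in> W)" and x: "x \<in> carrier R"
    then have W: "S \<subseteq> W" "\<zero> \<in> W" "\<And>x y. x \<in> W \<Longrightarrow> y \<in> W \<Longrightarrow> x \<oplus> y \<in> W"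
      "\<And>r x. r \<in> carrier R \<Longrightarrow> x \<in> W \<Longrightarrow> r [^] p \<otimes> x \<in> W" by auto
    obtain a where a: "a \<in> S \<rightarrow> pth_powers p R (carrier R)" and xa: "x = (\<Oplus>s \<in> S. a s \<otimes> s)"
      using span x by blast
    have pc: "pth_powers p R (carrier R) \<subseteq> carrier R" by (auto simp: pth_powers_def)
    show "x \<in> W"
      unfolding xa
    proof (rule finsum_mem[OF S(1) W(2,3)])
      fix s assume s: "s \<in> S"
      then have "a s \<in> pth_powers p R (carrier R)" using a by blast
      then obtain r where "r \<in> carrier R" "a s = r [^] p" by (auto simp: pth_powers_def)
      then show "a s \<otimes> s \<in> W" using W s by auto
    qed (use a pc S in auto)
  qed (use S in auto)
  then show ?case
    using Suc frob_generates_Suc S(1) by (meson finite_SigmaI finite_imageI)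
qed

text \<open>The form in which strong F-regularity is used: a splitting of the map \<open>R \<rightarrow> \<^sup>eR\<close>, \<open>1 \<mapsto> c\<close>, is a
functional on \<open>\<^sup>eR\<close> with value 1 at \<open>c\<close>.\<close>
lemma strongly_F_regular_functional:
  assumes sfr: "strongly_F_regular p R" and noeth: "noetherian_ring R" and c: "c \<in> carrier R"
    and nzd: "\<And>y. y \<in> carrier R \<Longrightarrow> c \<otimes> y = \<zero> \<Longrightarrow> y = \<zero>"
  obtains e \<phi> where "\<phi> \<in> Hom e 0" "\<phi> c = \<one>"
proof -
  have "\<forall>P. minimal_prime P R \<longrightarrow> c \<notin> P"
    using not_in_minimal_prime[OF noeth c nzd] by blast
  then obtain e where "splits R (regular_module R) (frobenius_module p e R)
      (\<lambda>r \<in> carrier R. r \<odot>\<^bsub>frobenius_module p e R\<^esub> c)"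
    using sfr c unfolding strongly_F_regular_def by blast
  then obtain \<phi> where \<phi>: "\<phi> \<in> mod_hom R (frobenius_module p e R) (regular_module R)"
    and split: "\<And>r. r \<in> carrier R \<Longrightarrow> \<phi> (r [^] (p ^ e) \<otimes> c) = r"
    by (auto simp: splits_def regular_module_def frobenius_module_def with_action_def)
  have "\<phi> \<in> Hom e 0"
    using \<phi> by (auto simp: Hom_iff mod_hom_def regular_module_def frobenius_module_def with_action_def)
  moreover have "\<phi> c = \<one>"
    using split[of \<one>] c by simp
  ultimately show ?thesis using that by blast
qed

text \<open>Complete \<open>x\<close> by \<open>y\<close> with \<open>x y = 0\<close> to a nonzerodivisor and take a functional \<open>\<phi>\<close> with
\<open>\<phi> x + \<phi> y = 1\<close>.  Linearity shows that \<open>\<phi>\<close> maps annihilators into themselves, so \<open>x \<phi> y = 0\<close> and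
\<open>y \<phi> x = 0\<close>, hence \<open>\<phi> x \<phi> y = 0\<close> and \<open>\<phi> x\<close> is idempotent.  If it is 0 then \<open>x = 0\<close>; if it is 1 then
\<open>y = 0\<close> and \<open>x\<close> itself is a nonzerodivisor.\<close>
lemma strongly_F_regular_domain:
  assumes sfr: "strongly_F_regular p R" and noeth: "noetherian_ring R"
    and idem: "\<And>e. e \<in> carrier R \<Longrightarrow> e \<otimes> e = e \<Longrightarrow> e = \<zero> \<or> e = \<one>"
  shows "domain R"
proof (rule domain.intro[OF is_cring], unfold_locales)
  show "\<one> \<noteq> \<zero>" by (rule one_neq_zero)
  fix x b assume xb: "x \<otimes> b = \<zero>" and x: "x \<in> carrier R" and b: "b \<in> carrier R"
  have red: "reduced_ring R" using sfr by (simp add: strongly_F_regular_def)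
  obtain y where y: "y \<in> carrier R" and xy: "x \<otimes> y = \<zero>"
    and ann: "\<And>z. z \<in> carrier R \<Longrightarrow> x \<otimes> z = \<zero> \<Longrightarrow> y \<otimes> z = \<zero> \<Longrightarrow> z = \<zero>"
    using nonzerodivisor_from_zero_divisors[OF noeth red x] by blast
  have sq: "z = \<zero>" if "z \<in> carrier R" "z \<otimes> z = \<zero>" for z
    using red that unfolding reduced_ring_def by (metis nat_pow_0 nat_pow_Suc l_one)
  have nzd: "z = \<zero>" if z: "z \<in> carrier R" "(x \<oplus> y) \<otimes> z = \<zero>" for z
  proof (rule ann[OF z(1)])
    have sum: "x \<otimes> z \<oplus> y \<otimes> z = \<zero>" using z x y by (simp add: l_distr)
    have "(x \<otimes> z) \<otimes> (x \<otimes> z) = (x \<otimes> z) \<otimes> (x \<otimes> z \<oplus> y \<otimes> z) \<ominus> (x \<otimes> y) \<otimes> (z \<otimes> z)"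
      using x y z(1) by algebra
    also have "\<dots> = \<zero>" using x y z(1) by (simp add: sum xy minus_eq)
    finally show xz: "x \<otimes> z = \<zero>" using sq[of "x \<otimes> z"] x z(1) by simp
    show "y \<otimes> z = \<zero>" using sum xz y z(1) by simp
  qed
  obtain e \<phi> where \<phi>: "\<phi> \<in> Hom e 0" and one: "\<phi> (x \<oplus> y) = \<one>"
    using strongly_F_regular_functional[OF sfr noeth _ nzd] x y by blast
  have \<phi>x: "\<phi> x \<in> carrier R" and \<phi>y: "\<phi> y \<in> carrier R" using Hom_closed[OF \<phi>] x y by simp_all
  have kill: "a \<otimes> \<phi> b = \<zero>" if a: "a \<in> carrier R" and b: "b \<in> carrier R" and ab: "a \<otimes> b = \<zero>" for a b
  proof -
    have "p ^ e \<noteq> 0" using p_gt_0 by simp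
    then obtain k where k: "p ^ e = Suc k" using not0_implies_Suc by blast
    have "a [^] (p ^ e) \<otimes> b = a [^] k \<otimes> (a \<otimes> b)"
      using a b by (simp add: k m_assoc)
    also have "\<dots> = \<zero>" using a ab by simp
    finally have "\<phi> (a [^] (p ^ e) \<otimes> b) = \<zero>" using Hom_zero[OF \<phi>] by simp
    then show ?thesis using Hom_smult[OF \<phi> a b] a by simp
  qed
  have x\<phi>y: "x \<otimes> \<phi> y = \<zero>" and y\<phi>x: "y \<otimes> \<phi> x = \<zero>"
    using kill[OF x y xy] kill[OF y x] xy x y by (simp_all add: m_comm)
  have sum: "\<phi> x \<oplus> \<phi> y = \<one>" using one Hom_add[OF \<phi> x y] by simp
  have prod: "\<phi> x \<otimes> \<phi> y = \<zero>"
  proof (rule ann)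
    show "\<phi> x \<otimes> \<phi> y \<in> carrier R" using \<phi>x \<phi>y by simp
    show "x \<otimes> (\<phi> x \<otimes> \<phi> y) = \<zero>"
      using x\<phi>y x \<phi>x \<phi>y by (simp add: m_lcomm[of x])
    show "y \<otimes> (\<phi> x \<otimes> \<phi> y) = \<zero>"
      using y\<phi>x y \<phi>x \<phi>y by (simp add: m_assoc[symmetric])
  qed
  have "\<phi> x = \<phi> x \<otimes> (\<phi> x \<oplus> \<phi> y)" using sum \<phi>x by simp
  also have "\<dots> = \<phi> x \<otimes> \<phi> x" using prod \<phi>x \<phi>y by (simp add: r_distr)
  finally have "\<phi> x = \<zero> \<or> \<phi> x = \<one>" using idem \<phi>x by metis
  then show "x = \<zero> \<or> b = \<zero>"
  proof
    assume "\<phi> x = \<zero>"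
    then have "\<phi> y = \<one>" using sum \<phi>y by simp
    then show ?thesis using x\<phi>y x by simp
  next
    assume "\<phi> x = \<one>"
    then have "y = \<zero>" using y\<phi>x y by simp
    then have "b = \<zero>" using ann[OF b xb] b by simp
    then show ?thesis ..
  qed
qed

text \<open>Over a field, a linear complement of the \<open>p\<close>-th powers is obtained as a maximal subspace \<open>W\<close> not
containing 1: for \<open>x\<close> outside \<open>W\<close>, maximality puts 1 into \<open>W + R\<^sup>p x\<close>, and solving for
\<open>x\<close> exhibits it as a \<open>p\<close>-th power plus an element of \<open>W\<close>.  The splitting reads off the \<open>p\<close>-th root.\<close>
lemma field_F_split:
  assumes units: "\<And>a. a \<in> carrier R \<Longrightarrow> a \<noteq> \<zero> \<Longrightarrow> \<exists>b \<in> carrier R. b \<otimes> a = \<one>"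
  obtains \<pi> where "\<pi> \<in> Hom 1 0" "\<pi> \<one> = \<one>"
proof -
  define F where "F = {W. W \<subseteq> carrier R \<and> \<zero> \<in> W \<and> (\<forall>x \<in> W. \<forall>y \<in> W. x \<oplus> y \<in> W) \<and>
    (\<forall>r \<in> carrier R. \<forall>x \<in> W. r [^] p \<otimes> x \<in> W) \<and> \<one> \<notin> W}"
  have "\<exists>W \<in> F. \<forall>W' \<in> F. W \<subseteq> W' \<longrightarrow> W' = W"
  proof (rule subset_Zorn_nonempty)
    have "{\<zero>} \<in> F" using one_neq_zero by (simp add: F_def)
    then show "F \<noteq> {}" by blast
    fix C assume C: "C \<noteq> {}" "subset.chain F C"
    then have CF: "C \<subseteq> F" and lin: "\<And>V W. V \<in> C \<Longrightarrow> W \<in> C \<Longrightarrow> V \<subseteq> W \<or> W \<subseteq> V"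
      by (auto simp: pred_on.chain_def)
    have add: "x \<oplus> y \<in> \<Union>C" if xy: "x \<in> \<Union>C" "y \<in> \<Union>C" for x y
    proof -
      obtain V W where VW: "V \<in> C" "x \<in> V" "W \<in> C" "y \<in> W" using xy by blast
      then obtain Y where "Y \<in> C" "x \<in> Y" "y \<in> Y" using lin[of V W] by blast
      moreover from this have "x \<oplus> y \<in> Y" using CF unfolding F_def by blast
      ultimately show ?thesis by blast
    qed
    have "\<zero> \<in> \<Union>C" using C CF by (auto simp: F_def)
    moreover have "r [^] p \<otimes> x \<in> \<Union>C" if "r \<in> carrier R" "x \<in> \<Union>C" for r x
      using CF that unfolding F_def by blast
    moreover have "\<Union>C \<subseteq> carrier R" "\<one> \<notin> \<Union>C" using CF by (auto simp: F_def)
    ultimately show "\<Union>C \<in> F" using add by (simp add: F_def)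
  qed
  then obtain W where WF: "W \<in> F" and max: "\<And>W'. W' \<in> F \<Longrightarrow> W \<subseteq> W' \<Longrightarrow> W' = W" by blast
  have WR: "W \<subseteq> carrier R" and W0: "\<zero> \<in> W" and Wadd: "\<And>x y. x \<in> W \<Longrightarrow> y \<in> W \<Longrightarrow> x \<oplus> y \<in> W"
    and Wmult: "\<And>r x. r \<in> carrier R \<Longrightarrow> x \<in> W \<Longrightarrow> r [^] p \<otimes> x \<in> W" and W1: "\<one> \<notin> W"
    using WF by (auto simp: F_def)
  have Wneg: "\<ominus> x \<in> W" if "x \<in> W" for x
    using Wmult[of "\<ominus> \<one>" x] that WR by (auto simp: minus_one_pow_p l_minus)
  have padd: "(x \<oplus> y) [^] p = x [^] p \<oplus> y [^] p" if "x \<in> carrier R" "y \<in> carrier R" for x y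
    using frobenius_add[OF that, of 1] by simp
  have ex: "\<exists>b \<in> carrier R. \<exists>w \<in> W. x = b [^] p \<oplus> w" if x: "x \<in> carrier R" for x
  proof (cases "x \<in> W")
    case True
    then show ?thesis using p_gt_0 WR by (intro bexI[of _ \<zero>] bexI[of _ x]) (auto simp: nat_pow_zero)
  next
    case False
    define V where "V = {w \<oplus> r [^] p \<otimes> x | w r. w \<in> W \<and> r \<in> carrier R}"
    have Vi: "w \<oplus> r [^] p \<otimes> x \<in> V" if "w \<in> W" "r \<in> carrier R" for w r
      using that unfolding V_def by blast
    have WV: "W \<subseteq> V"
    proof
      fix w assume w: "w \<in> W"
      then have "w \<oplus> \<zero> [^] p \<otimes> x = w" using x WR p_gt_0 by (auto simp: nat_pow_zero)
      with Vi[OF w zero_closed] show "w \<in> V" by metis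
    qed
    have "\<zero> \<oplus> \<one> [^] p \<otimes> x = x" using x by simp
    with Vi[OF W0 one_closed] have "x \<in> V" by metis
    then have neq: "V \<noteq> W" using False by blast
    have "\<one> \<in> V"
    proof (rule ccontr)
      assume no: "\<one> \<notin> V"
      have "V \<in> F"
      proof -
        have sub: "V \<subseteq> carrier R" using WR x by (auto simp: V_def)
        have add: "a \<oplus> b \<in> V" if ab: "a \<in> V" "b \<in> V" for a b
        proof -
          obtain w r w' r' where e: "a = w \<oplus> r [^] p \<otimes> x" "w \<in> W" "r \<in> carrier R"
            "b = w' \<oplus> r' [^] p \<otimes> x" "w' \<in> W" "r' \<in> carrier R" using ab unfolding V_def by blast
          then have "a \<oplus> b = (w \<oplus> w') \<oplus> (r \<oplus> r') [^] p \<otimes> x"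
            using x WR by (simp add: padd l_distr a_ac subset_iff)
          with Vi[of "w \<oplus> w'" "r \<oplus> r'"] show ?thesis using e Wadd by simp
        qed
        have smult: "s [^] p \<otimes> a \<in> V" if s: "s \<in> carrier R" and a: "a \<in> V" for s a
        proof -
          obtain w r where e: "a = w \<oplus> r [^] p \<otimes> x" "w \<in> W" "r \<in> carrier R" using a unfolding V_def by blast
          then have "s [^] p \<otimes> a = s [^] p \<otimes> w \<oplus> (s \<otimes> r) [^] p \<otimes> x"
            using x s WR by (simp add: nat_pow_distrib r_distr m_assoc subset_iff)
          with Vi[of "s [^] p \<otimes> w" "s \<otimes> r"] show ?thesis using e s Wmult by simp
        qed
        have "\<zero> \<in> V" using WV W0 by (rule subsetD)
        then show ?thesis using sub add smult no unfolding F_def by (intro CollectI conjI ballI)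
      qed
      then show False using max WV neq by blast
    qed
    then obtain w r where wr: "\<one> = w \<oplus> r [^] p \<otimes> x" "w \<in> W" "r \<in> carrier R"
      unfolding V_def by blast
    have wR: "w \<in> carrier R" using wr WR by blast
    have "r \<noteq> \<zero>"
    proof
      assume "r = \<zero>"
      then have "w = \<one>" using wr(1) wR x p_gt_0 by (simp add: nat_pow_zero)
      then show False using W1 wr by simp
    qed
    then obtain s where s: "s \<in> carrier R" "s \<otimes> r = \<one>" using units wr by blast
    have sr: "s [^] p \<otimes> r [^] p = \<one>"
      using s wr(3) nat_pow_distrib[of s r p] by simp
    have "s [^] p \<oplus> \<ominus> (s [^] p \<otimes> w) = s [^] p \<otimes> (\<one> \<ominus> w)"
      using s(1) wR nat_pow_closed[OF s(1), of p] by algebra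
    also have "\<one> \<ominus> w = r [^] p \<otimes> x"
      using wR nat_pow_closed[OF wr(3), of p] x unfolding wr(1) by algebra
    also have "s [^] p \<otimes> (r [^] p \<otimes> x) = x"
      using s(1) wr(3) x sr by (simp add: m_assoc[symmetric])
    finally show ?thesis using s wr Wmult Wneg by metis
  qed
  have unique: "b = b'" if b: "b \<in> carrier R" "b' \<in> carrier R" and w: "w \<in> W" "w' \<in> W"
    and eq: "b [^] p \<oplus> w = b' [^] p \<oplus> w'" for b b' w w'
  proof (rule ccontr)
    assume neq: "b \<noteq> b'"
    let ?d = "b \<ominus> b'"
    have wR: "w \<in> carrier R" "w' \<in> carrier R" using w WR by auto
    have neg: "(\<ominus> b') [^] p = \<ominus> (b' [^] p)"
    proof -
      have "(\<ominus> b') [^] p = (\<ominus> \<one> \<otimes> b') [^] p" using b by (simp add: l_minus)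
      also have "\<dots> = (\<ominus> \<one>) [^] p \<otimes> b' [^] p" using b by (intro nat_pow_distrib) auto
      finally show ?thesis using b by (simp add: minus_one_pow_p l_minus)
    qed
    have "?d [^] p = b [^] p \<ominus> b' [^] p"
      using b by (simp add: minus_eq padd neg)
    also have "\<dots> = (b [^] p \<oplus> w) \<ominus> (b' [^] p \<oplus> w') \<oplus> (w' \<ominus> w)"
      using wR nat_pow_closed[OF b(1), of p] nat_pow_closed[OF b(2), of p] by algebra
    also have "\<dots> = w' \<oplus> \<ominus> w"
      unfolding eq using wR b by (simp add: minus_eq r_neg)
    also have "\<dots> \<in> W" using w Wadd Wneg by blast
    finally have dW: "?d [^] p \<in> W" .
    have dR: "?d \<in> carrier R" and "?d \<noteq> \<zero>" using b neq by auto
    then obtain s where s: "s \<in> carrier R" "s \<otimes> ?d = \<one>" using units by blast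
    have "s [^] p \<otimes> ?d [^] p = (s \<otimes> ?d) [^] p" by (rule nat_pow_distrib[OF s(1) dR, symmetric])
    also have "\<dots> = \<one>" by (simp add: s)
    finally show False using Wmult[OF s(1) dW] W1 by simp
  qed
  define \<pi> where "\<pi> x = (THE b. b \<in> carrier R \<and> (\<exists>w \<in> W. x = b [^] p \<oplus> w))" for x
  have \<pi>: "\<pi> (b [^] p \<oplus> w) = b" if "b \<in> carrier R" "w \<in> W" for b w
    unfolding \<pi>_def using that unique by (intro the_equality) auto
  have "restrict \<pi> (carrier R) \<in> Hom 1 0"
  proof (rule HomI)
    fix x y assume "x \<in> carrier R" "y \<in> carrier R"
    then obtain b w b' w' where e: "x = b [^] p \<oplus> w" "b \<in> carrier R" "w \<in> W"
      "y = b' [^] p \<oplus> w'" "b' \<in> carrier R" "w' \<in> W" using ex by metis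
    have "x \<oplus> y = (b \<oplus> b') [^] p \<oplus> (w \<oplus> w')"
      using e WR by (simp add: padd a_ac subset_iff)
    then have "\<pi> (x \<oplus> y) = b \<oplus> b'" using \<pi>[of "b \<oplus> b'" "w \<oplus> w'"] Wadd e by simp
    then show "\<pi> (x \<oplus> y) = \<pi> x \<oplus> \<pi> y" using \<pi> e by simp
    show "\<pi> x \<in> carrier R" using \<pi> e by simp
  next
    fix r x assume r: "r \<in> carrier R" and "x \<in> carrier R"
    then obtain b w where e: "x = b [^] p \<oplus> w" "b \<in> carrier R" "w \<in> W" using ex by metis
    have "r [^] p \<otimes> x = (r \<otimes> b) [^] p \<oplus> r [^] p \<otimes> w"
      using e WR r by (simp add: nat_pow_distrib r_distr subset_iff)
    then show "\<pi> (r [^] p ^ 1 \<otimes> x) = r [^] p ^ 0 \<otimes> \<pi> x"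
      using \<pi>[of "r \<otimes> b" "r [^] p \<otimes> w"] \<pi>[of b w] Wmult e r by simp
  qed
  moreover have "restrict \<pi> (carrier R) \<one> = \<one>" using \<pi>[OF one_closed W0] by simp
  ultimately show ?thesis using that by blast
qed

text \<open>For a unit \<open>c\<close> the exponent supplied by strong F-regularity may be 0 and carry no information,
which is why fields are treated separately.  For a nonunit \<open>c \<noteq> 0\<close> the exponent is positive,
and restricting the functional to the multiples \<open>x ^ (p ^ (e - 1)) c\<close> splits Frobenius.\<close>
lemma strongly_F_regular_F_split:
  assumes sfr: "strongly_F_regular p R" and noeth: "noetherian_ring R" and dom: "domain R"
  obtains \<pi> where "\<pi> \<in> Hom 1 0" "\<pi> \<one> = \<one>"
proof (cases "\<forall>a \<in> carrier R. a \<noteq> \<zero> \<longrightarrow> (\<exists>b \<in> carrier R. b \<otimes> a = \<one>)")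
  case True
  then show ?thesis using field_F_split that by blast
next
  case False
  then obtain c where c: "c \<in> carrier R" "c \<noteq> \<zero>" and nonunit: "\<And>b. b \<in> carrier R \<Longrightarrow> b \<otimes> c \<noteq> \<one>"
    by blast
  obtain e \<phi> where \<phi>: "\<phi> \<in> Hom e 0" and one: "\<phi> c = \<one>"
    using strongly_F_regular_functional[OF sfr noeth c(1)] domain.integral[OF dom _ c(1)] c by metis
  have "e \<noteq> 0"
  proof
    assume "e = 0"
    then have "\<phi> (c \<otimes> \<one>) = c \<otimes> \<phi> \<one>" using Hom_smult[OF \<phi> c(1) one_closed] c(1) by simp
    then have "\<phi> \<one> \<otimes> c = \<one>" using one c(1) Hom_closed[OF \<phi> one_closed] by (simp add: m_comm)
    then show False using nonunit Hom_closed[OF \<phi> one_closed] by blast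
  qed
  then obtain k where k: "e = Suc k" using not0_implies_Suc by blast
  have "(\<lambda>x \<in> carrier R. \<phi> (x [^] (p ^ k) \<otimes> c)) \<in> Hom 1 0"
  proof (rule HomI)
    fix x y assume "x \<in> carrier R" "y \<in> carrier R"
    then show "\<phi> ((x \<oplus> y) [^] (p ^ k) \<otimes> c) = \<phi> (x [^] (p ^ k) \<otimes> c) \<oplus> \<phi> (y [^] (p ^ k) \<otimes> c)"
      using c(1) \<phi> by (simp add: frobenius_add l_distr Hom_add)
    show "\<phi> (x [^] (p ^ k) \<otimes> c) \<in> carrier R" using \<open>x \<in> carrier R\<close> c(1) \<phi> by (simp add: Hom_closed)
  next
    fix r x assume r: "r \<in> carrier R" and x: "x \<in> carrier R"
    have "(r [^] p ^ 1 \<otimes> x) [^] (p ^ k) \<otimes> c = r [^] (p ^ e) \<otimes> (x [^] (p ^ k) \<otimes> c)"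
      using r x c(1) by (simp add: k nat_pow_distrib nat_pow_pow m_assoc)
    then show "\<phi> ((r [^] p ^ 1 \<otimes> x) [^] (p ^ k) \<otimes> c) = r [^] p ^ 0 \<otimes> \<phi> (x [^] (p ^ k) \<otimes> c)"
      using Hom_smult[OF \<phi> r, of "x [^] (p ^ k) \<otimes> c"] x c(1) by simp
  qed
  moreover have "(\<lambda>x \<in> carrier R. \<phi> (x [^] (p ^ k) \<otimes> c)) \<one> = \<one>" using one c(1) by simp
  ultimately show ?thesis using that by blast
qed

end

section \<open>The ring of differential operators\<close>

context prime_char_ring begin

abbreviation comp_on :: "('a \<Rightarrow> 'a) \<Rightarrow> ('a \<Rightarrow> 'a) \<Rightarrow> 'a \<Rightarrow> 'a"  (infixr \<open>\<star>\<close> 70)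
  where "f \<star> g \<equiv> compose (carrier R) f g"

definition add_map :: "('a \<Rightarrow> 'a) \<Rightarrow> ('a \<Rightarrow> 'a) \<Rightarrow> 'a \<Rightarrow> 'a"
  where "add_map f g = (\<lambda>x \<in> carrier R. f x \<oplus> g x)"

lemma add_map_apply [simp]: "x \<in> carrier R \<Longrightarrow> add_map f g x = f x \<oplus> g x"
  by (simp add: add_map_def)

lemma add_map_Hom: "f \<in> Hom a b \<Longrightarrow> g \<in> Hom a b \<Longrightarrow> add_map f g \<in> Hom a b"
  unfolding add_map_def
  by (rule HomI) (simp_all add: Hom_closed Hom_add Hom_smult r_distr a_ac)

lemma zero_map_Hom: "zero_map \<in> Hom a b"
  unfolding zero_map_def by (rule HomI) simp_all

lemma neg_map_Hom: "f \<in> Hom a b \<Longrightarrow> (\<lambda>x \<in> carrier R. \<ominus> f x) \<in> Hom a b"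
  by (rule HomI) (simp_all add: Hom_closed Hom_add Hom_smult r_minus minus_add)

lemma Hom_eqI:
  assumes "f \<in> Hom a b" "g \<in> Hom c d" "\<And>x. x \<in> carrier R \<Longrightarrow> f x = g x"
  shows "f = g"
  using assms by (intro extensionalityI[of f "carrier R" g]) (auto dest: Hom_ext)

lemma diff_ops_int_simps:
  "monoid.mult (diff_ops_int R) = (\<star>)"
  "one (diff_ops_int R) = (\<lambda>x \<in> carrier R. x)"
  "ring.zero (diff_ops_int R) = zero_map"
  "add (diff_ops_int R) = add_map"
  by (simp_all add: diff_ops_int_def diff_ops_def int_algebra_def with_action_def zero_map_def
      add_map_def fun_eq_iff)

lemma carrier_diff_ops_int:
  assumes "\<And>e. \<exists>U. finite U \<and> frob_generates e U"
  shows "carrier (diff_ops_int R) = (\<Union>e. Hom e e)"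
proof -
  have "carrier (diff_ops_int R) = (\<Union>n. diff_le n)"
    by (simp add: diff_ops_int_def diff_ops_def)
  also have "\<dots> = (\<Union>e. Hom e e)"
  proof (rule equalityI)
    show "(\<Union>n. diff_le n) \<subseteq> (\<Union>e. Hom e e)"
      by (intro UN_mono subset_refl diff_le_subset_Hom)
    have "Hom e e \<subseteq> (\<Union>n. diff_le n)" for e
    proof -
      obtain U where "finite U" "frob_generates e U" using assms by blast
      then have "Hom e e \<subseteq> diff_le (card U * p ^ e)" by (intro Hom_subset_diff_le)
      then show ?thesis by (rule order_trans) (rule UN_upper, simp)
    qed
    then show "(\<Union>e. Hom e e) \<subseteq> (\<Union>n. diff_le n)" by (intro UN_least)
  qed
  finally show ?thesis .
qed

lemma Hom_common:
  assumes "f \<in> (\<Union>e. Hom e e)" "g \<in> (\<Union>e. Hom e e)"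
  obtains e where "f \<in> Hom e e" "g \<in> Hom e e"
proof -
  obtain a b where "f \<in> Hom a a" "g \<in> Hom b b" using assms by blast
  then have "f \<in> Hom (max a b) (max a b)" "g \<in> Hom (max a b) (max a b)"
    using Hom_mono[of a "max a b"] Hom_mono[of b "max a b"] by auto
  then show ?thesis by (rule that)
qed

lemma compose_apply: "x \<in> carrier R \<Longrightarrow> (f \<star> g) x = f (g x)"
  by (simp add: compose_def)

lemma ring_diff_ops_int:
  assumes gens: "\<And>e. \<exists>U. finite U \<and> frob_generates e U"
  shows "ring (diff_ops_int R)"
proof -
  let ?E = "\<Union>e. Hom e e"
  have E_closed: "f x \<in> carrier R" if "f \<in> ?E" "x \<in> carrier R" for f x
    using that Hom_closed by blast
  have E_add: "f (x \<oplus> y) = f x \<oplus> f y" if "f \<in> ?E" "x \<in> carrier R" "y \<in> carrier R" for f x y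
    using that Hom_add by blast
  have E_eqI: "f = g" if "f \<in> ?E" "g \<in> ?E" "\<And>x. x \<in> carrier R \<Longrightarrow> f x = g x" for f g
    using that Hom_eqI by blast
  have comp: "f \<star> g \<in> ?E" and add: "add_map f g \<in> ?E" if fg: "f \<in> ?E" "g \<in> ?E" for f g
  proof -
    obtain e where "f \<in> Hom e e" "g \<in> Hom e e" using Hom_common[OF fg] by blast
    then have "f \<star> g \<in> Hom e e" "add_map f g \<in> Hom e e"
      by (auto intro: Hom_compose add_map_Hom)
    then show "f \<star> g \<in> ?E" "add_map f g \<in> ?E" by blast+
  qed
  have zero: "zero_map \<in> ?E" using zero_map_Hom by blast
  have id: "(\<lambda>x \<in> carrier R. x) \<in> ?E" using id_Hom by blast
  note simps = diff_ops_int_simps carrier_diff_ops_int[OF gens]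
  show ?thesis
  proof (rule ringI)
    show "abelian_group (diff_ops_int R)"
    proof (rule abelian_groupI, unfold simps)
      fix f g h assume f: "f \<in> ?E" and g: "g \<in> ?E" and h: "h \<in> ?E"
      show "add_map f g \<in> ?E" by (rule add[OF f g])
      show "add_map (add_map f g) h = add_map f (add_map g h)"
        by (rule E_eqI) (use f g h in \<open>simp_all only: add add_map_apply E_closed a_assoc\<close>)
      show "add_map f g = add_map g f"
        by (rule E_eqI) (use f g in \<open>simp_all only: add add_map_apply E_closed a_comm\<close>)
    next
      show "zero_map \<in> ?E" by (rule zero)
    next
      fix f assume f: "f \<in> ?E"
      show "add_map zero_map f = f"
        by (rule E_eqI) (use f in \<open>simp_all only: zero add add_map_apply zero_map_apply E_closed l_zero\<close>)
      let ?g = "\<lambda>x \<in> carrier R. \<ominus> f x"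
      have g: "?g \<in> ?E" using f neg_map_Hom by blast
      have "add_map ?g f = zero_map"
      proof (rule E_eqI[OF add[OF g f] zero])
        fix x assume x: "x \<in> carrier R"
        then show "add_map ?g f x = zero_map x" using E_closed[OF f x] by (simp add: l_neg)
      qed
      then show "\<exists>g \<in> ?E. add_map g f = zero_map" using g by blast
    qed
    show "monoid (diff_ops_int R)"
    proof (rule monoidI, unfold simps)
      fix f g h assume f: "f \<in> ?E" and g: "g \<in> ?E" and h: "h \<in> ?E"
      show "f \<star> g \<in> ?E" by (rule comp[OF f g])
      show "(f \<star> g) \<star> h = f \<star> g \<star> h"
        by (rule E_eqI) (use f g h in \<open>simp_all only: comp compose_apply E_closed\<close>)
    next
      show "(\<lambda>x \<in> carrier R. x) \<in> ?E" by (rule id)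
    next
      fix f assume f: "f \<in> ?E"
      show "(\<lambda>x \<in> carrier R. x) \<star> f = f"
        by (rule E_eqI) (use f in \<open>simp_all only: id comp compose_apply E_closed restrict_apply if_True\<close>)
      show "f \<star> (\<lambda>x \<in> carrier R. x) = f"
        by (rule E_eqI) (use f in \<open>simp_all only: id comp compose_apply E_closed restrict_apply if_True\<close>)
    qed
  next
    fix f g h
    assume "f \<in> carrier (diff_ops_int R)" "g \<in> carrier (diff_ops_int R)" "h \<in> carrier (diff_ops_int R)"
    then have f: "f \<in> ?E" and g: "g \<in> ?E" and h: "h \<in> ?E" by (simp_all only: simps)
    show "(f \<oplus>\<^bsub>diff_ops_int R\<^esub> g) \<otimes>\<^bsub>diff_ops_int R\<^esub> h =
        (f \<otimes>\<^bsub>diff_ops_int R\<^esub> h) \<oplus>\<^bsub>diff_ops_int R\<^esub> (g \<otimes>\<^bsub>diff_ops_int R\<^esub> h)"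
      unfolding simps
      by (rule E_eqI) (use f g h in \<open>simp_all only: comp add compose_apply add_map_apply E_closed\<close>)
    show "h \<otimes>\<^bsub>diff_ops_int R\<^esub> (f \<oplus>\<^bsub>diff_ops_int R\<^esub> g) =
        (h \<otimes>\<^bsub>diff_ops_int R\<^esub> f) \<oplus>\<^bsub>diff_ops_int R\<^esub> (h \<otimes>\<^bsub>diff_ops_int R\<^esub> g)"
      unfolding simps
      by (rule E_eqI) (use f g h in \<open>simp_all only: comp add compose_apply add_map_apply E_closed E_add\<close>)
  qed
qed

lemma iterated_splitting:
  assumes \<pi>: "\<pi> \<in> Hom 1 0" "\<pi> \<one> = \<one>"
  obtains \<rho> where "\<rho> \<in> Hom k 0" "\<And>x. x \<in> carrier R \<Longrightarrow> \<rho> (x [^] (p ^ k)) = x"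
proof -
  have "\<exists>\<rho> \<in> Hom k 0. \<rho> \<one> = \<one>"
  proof (induction k)
    case 0
    then show ?case using id_Hom by (intro bexI[of _ "\<lambda>x \<in> carrier R. x"]) auto
  next
    case (Suc k)
    then obtain \<rho> where \<rho>: "\<rho> \<in> Hom k 0" "\<rho> \<one> = \<one>" by blast
    have "\<rho> \<in> Hom (Suc k) 1" using Hom_shift[OF \<rho>(1), of 1] by simp
    then have "\<pi> \<star> \<rho> \<in> Hom (Suc k) 0" using \<pi>(1) by (rule Hom_compose)
    then show ?case using \<rho> \<pi> by (intro bexI[of _ "\<pi> \<star> \<rho>"]) (auto simp: compose_apply)
  qed
  then obtain \<rho> where \<rho>: "\<rho> \<in> Hom k 0" "\<rho> \<one> = \<one>" by blast
  have "\<rho> (x [^] (p ^ k)) = x" if "x \<in> carrier R" for x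
    using Hom_smult[OF \<rho>(1) that one_closed] \<rho>(2) that by simp
  with \<rho>(1) show ?thesis by (rule that)
qed

text \<open>Finite F-representation type enters the proof of simplicity only through this condition: every
\<open>\<^sup>eR\<close> is a direct summand of a finite direct sum of copies of \<open>\<^sup>fR\<close>, that is, its identity is a
sum of endomorphisms factoring through \<open>\<^sup>fR\<close>.\<close>
definition generating_level :: "nat \<Rightarrow> bool"
  where "generating_level f \<longleftrightarrow> (\<forall>e. \<exists>(k :: nat) \<alpha> \<beta>.
    (\<forall>i < k. \<alpha> i \<in> Hom e f \<and> \<beta> i \<in> Hom f e) \<and>
    (\<forall>x \<in> carrier R. (\<Oplus>i \<in> {..<k}. \<beta> i (\<alpha> i x)) = x))"

text \<open>Starting from a nonzero operator in the ideal, multiplication on both sides first produces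
\<open>\<eta>\<close> with \<open>\<eta> 1 = 1\<close>, then the projection \<open>Frob E \<star> \<rho>\<close> of \<open>\<^sup>ER\<close> onto the copy of \<open>R\<close> formed by the
\<open>p ^ E\<close>-th powers, which \<open>\<eta>\<close> fixes.  Read with all levels raised by \<open>f\<close>, the same function projects
\<open>\<^sup>NR\<close> for \<open>N = f + E\<close> onto a copy of \<open>\<^sup>fR\<close>, so the ideal contains every endomorphism of \<open>\<^sup>NR\<close> that factors
through \<open>\<^sup>fR\<close>, and by the choice of \<open>f\<close> these add up to the identity.\<close>
lemma ideal_diff_ops_trivial:
  assumes gens: "\<And>e. \<exists>U. finite U \<and> frob_generates e U"
    and functional: "\<And>c. c \<in> carrier R \<Longrightarrow> c \<noteq> \<zero> \<Longrightarrow> \<exists>d. \<exists>\<phi> \<in> Hom d 0. \<phi> c = \<one>"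
    and \<pi>: "\<pi> \<in> Hom 1 0" "\<pi> \<one> = \<one>"
    and level: "generating_level f"
    and ideal: "ideal I (diff_ops_int R)" and nonzero: "I \<noteq> {zero_map}"
  shows "I = carrier (diff_ops_int R)"
proof -
  interpret I: ideal I "diff_ops_int R" by fact
  note simps = diff_ops_int_simps carrier_diff_ops_int[OF gens]
  have left: "\<psi> \<star> \<theta> \<in> I" and right: "\<theta> \<star> \<psi> \<in> I" if "\<theta> \<in> I" "\<psi> \<in> Hom e e" for \<theta> \<psi> e
    using I.I_l_closed[OF that(1), of \<psi>] I.I_r_closed[OF that(1), of \<psi>] that(2)
    unfolding simps by blast+
  have zero_I: "zero_map \<in> I" using additive_subgroup.zero_closed[OF ideal.axioms(1)[OF ideal]] unfolding simps .
  have add_I: "add_map \<theta> \<eta> \<in> I" if "\<theta> \<in> I" "\<eta> \<in> I" for \<theta> \<eta>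
    using additive_subgroup.a_closed[OF ideal.axioms(1)[OF ideal] that] unfolding simps .
  obtain \<theta> where \<theta>I: "\<theta> \<in> I" and \<theta>0: "\<theta> \<noteq> zero_map" using nonzero zero_I by blast
  obtain e where \<theta>: "\<theta> \<in> Hom e e" using I.Icarr[OF \<theta>I] unfolding simps by blast
  obtain x where x: "x \<in> carrier R" "\<theta> x \<noteq> \<zero>"
    using Hom_eqI[OF \<theta> zero_map_Hom] \<theta>0 by (metis zero_map_apply)
  obtain d \<phi> where \<phi>: "\<phi> \<in> Hom d 0" "\<phi> (\<theta> x) = \<one>"
    using functional[OF Hom_closed[OF \<theta> x(1)] x(2)] by blast
  let ?m = "\<lambda>y \<in> carrier R. x \<otimes> y"
  have F\<phi>: "Frob d \<star> \<phi> \<in> Hom d d"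
    using Hom_compose[OF \<phi>(1) Frob_Hom[of d 0]] by simp
  have m: "?m \<in> Hom 0 0" by (rule mult_Hom[OF x(1)])
  \<comment> \<open>\<open>Frob d \<star> \<phi>\<close> rather than \<open>\<phi>\<close>, because \<open>\<phi>\<close> maps \<open>\<^sup>dR\<close> to \<open>R\<close>; Frobenius brings it back to \<open>\<^sup>dR\<close>\<close>
  define \<eta> where "\<eta> = (Frob d \<star> \<phi>) \<star> (\<theta> \<star> ?m)"
  have \<eta>I: "\<eta> \<in> I" unfolding \<eta>_def by (intro left[OF _ F\<phi>] right[OF \<theta>I m])
  have \<eta>1: "\<eta> \<one> = \<one>" using x \<phi> Hom_closed[OF \<theta> x(1)] by (simp add: \<eta>_def compose_apply Frob_def)
  define E where "E = max d e"
  have "Hom d d \<subseteq> Hom E E" "Hom e e \<subseteq> Hom E E" "Hom 0 0 \<subseteq> Hom E E"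
    by (auto intro!: Hom_mono simp: E_def)
  then have "Frob d \<star> \<phi> \<in> Hom E E" "\<theta> \<in> Hom E E" "?m \<in> Hom E E"
    using F\<phi> \<theta> m by blast+
  then have \<eta>: "\<eta> \<in> Hom E E"
    unfolding \<eta>_def by (meson Hom_compose)
  have \<eta>_pow: "\<eta> (r [^] (p ^ E)) = r [^] (p ^ E)" if "r \<in> carrier R" for r
    using Hom_smult[OF \<eta>, of r \<one>] \<eta>1 that by simp
  obtain \<rho> where \<rho>: "\<rho> \<in> Hom E 0" and \<rho>_pow: "\<And>x. x \<in> carrier R \<Longrightarrow> \<rho> (x [^] (p ^ E)) = x"
    using iterated_splitting[OF \<pi>, of E] by metis
  have F\<rho>: "Frob E \<star> \<rho> \<in> Hom E E"
    using Hom_compose[OF \<rho> Frob_Hom[of E 0]] by simp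
  have "\<eta> \<star> (Frob E \<star> \<rho>) \<in> I" by (rule right[OF \<eta>I F\<rho>])
  also have "\<eta> \<star> (Frob E \<star> \<rho>) = Frob E \<star> \<rho>"
    by (rule Hom_eqI[OF Hom_compose[OF F\<rho> \<eta>] F\<rho>])
      (simp add: compose_apply Frob_def Hom_closed[OF \<rho>] \<eta>_pow)
  finally have F\<rho>I: "Frob E \<star> \<rho> \<in> I" .
  let ?N = "f + E"
  have factor: "\<beta> \<star> \<alpha> \<in> I" if \<alpha>: "\<alpha> \<in> Hom ?N f" and \<beta>: "\<beta> \<in> Hom f ?N" for \<alpha> \<beta>
  proof -
    have "\<rho> \<in> Hom ?N f" using Hom_shift[OF \<rho>, of f] by (simp add: add.commute)
    then have \<beta>\<rho>: "\<beta> \<star> \<rho> \<in> Hom ?N ?N" using \<beta> by (rule Hom_compose)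
    have F\<alpha>: "Frob E \<star> \<alpha> \<in> Hom ?N ?N" by (rule Hom_compose[OF \<alpha> Frob_Hom])
    have "(\<beta> \<star> \<rho>) \<star> ((Frob E \<star> \<rho>) \<star> (Frob E \<star> \<alpha>)) \<in> I"
      by (intro left[OF _ \<beta>\<rho>] right[OF F\<rho>I F\<alpha>])
    also have "(\<beta> \<star> \<rho>) \<star> ((Frob E \<star> \<rho>) \<star> (Frob E \<star> \<alpha>)) = \<beta> \<star> \<alpha>"
      unfolding compose_def
      by (rule restrict_ext) (simp add: Frob_def Hom_closed[OF \<alpha>] Hom_closed[OF \<rho>] \<rho>_pow)
    finally show ?thesis .
  qed
  obtain k :: nat and \<alpha> \<beta> where "\<forall>i < k. \<alpha> i \<in> Hom ?N f \<and> \<beta> i \<in> Hom f ?N"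
    and "\<forall>x \<in> carrier R. (\<Oplus>i \<in> {..<k}. \<beta> i (\<alpha> i x)) = x"
    using level[unfolded generating_level_def, rule_format, of ?N] by (elim exE conjE)
  then have \<alpha>\<beta>: "\<And>i. i < k \<Longrightarrow> \<alpha> i \<in> Hom ?N f" "\<And>i. i < k \<Longrightarrow> \<beta> i \<in> Hom f ?N"
    and sum: "\<And>x. x \<in> carrier R \<Longrightarrow> (\<Oplus>i \<in> {..<k}. \<beta> i (\<alpha> i x)) = x"
    by simp_all
  have "(\<lambda>x \<in> carrier R. \<Oplus>i \<in> {..<j}. \<beta> i (\<alpha> i x)) \<in> I" if "j \<le> k" for j
    using that
  proof (induction j)
    case 0
    have "(\<lambda>x \<in> carrier R. \<Oplus>i \<in> {..<0}. \<beta> i (\<alpha> i x)) = zero_map"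
      unfolding zero_map_def by (rule restrict_ext) simp
    then show ?case using zero_I by metis
  next
    case (Suc j)
    have "add_map (\<beta> j \<star> \<alpha> j) (\<lambda>x \<in> carrier R. \<Oplus>i \<in> {..<j}. \<beta> i (\<alpha> i x)) \<in> I"
    proof (rule add_I)
      show "\<beta> j \<star> \<alpha> j \<in> I" using Suc.prems \<alpha>\<beta>[of j] factor by simp
      show "(\<lambda>x \<in> carrier R. \<Oplus>i \<in> {..<j}. \<beta> i (\<alpha> i x)) \<in> I"
        by (rule Suc.IH) (use Suc.prems in simp)
    qed
    also have "add_map (\<beta> j \<star> \<alpha> j) (\<lambda>x \<in> carrier R. \<Oplus>i \<in> {..<j}. \<beta> i (\<alpha> i x)) =
        (\<lambda>x \<in> carrier R. \<Oplus>i \<in> {..<Suc j}. \<beta> i (\<alpha> i x))"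
      unfolding add_map_def
    proof (rule restrict_ext)
      fix x assume x: "x \<in> carrier R"
      have "\<beta> i (\<alpha> i x) \<in> carrier R" if "i \<le> j" for i
        using that Suc.prems \<alpha>\<beta> x by (meson Hom_closed le_trans not_less_eq_eq not_le)
      then show "(\<beta> j \<star> \<alpha> j) x \<oplus> (\<lambda>x \<in> carrier R. \<Oplus>i \<in> {..<j}. \<beta> i (\<alpha> i x)) x =
          (\<Oplus>i \<in> {..<Suc j}. \<beta> i (\<alpha> i x))"
        using x by (simp add: lessThan_Suc compose_apply Pi_def)
    qed
    finally show ?case .
  qed
  from this[OF order_refl] have "(\<lambda>x \<in> carrier R. \<Oplus>i \<in> {..<k}. \<beta> i (\<alpha> i x)) \<in> I" .
  also have "(\<lambda>x \<in> carrier R. \<Oplus>i \<in> {..<k}. \<beta> i (\<alpha> i x)) = (\<lambda>x \<in> carrier R. x)"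
    using sum by (intro restrict_ext)
  finally have "one (diff_ops_int R) \<in> I" unfolding simps .
  then show ?thesis by (rule I.one_imp_carrier)
qed

end

section \<open>Finite F-representation type\<close>

lemma internal_direct_sum_cong:
  fixes I :: "'i set" and N :: "'i \<Rightarrow> 'a set"
  assumes "carrier M = carrier M'" "add M = add M'" "ring.zero M = ring.zero M'"
  shows "internal_direct_sum M I N \<longleftrightarrow> internal_direct_sum M' I N"
proof -
  have "finsum M f A = finsum M' f A" for f :: "'i \<Rightarrow> 'a" and A
    by (simp add: finsum_def finprod_def assms)
  moreover have "additive_subgroup H M \<longleftrightarrow> additive_subgroup H M'" for H
    using assms by (simp add: additive_subgroup_def subgroup_def m_inv_def)
  ultimately show ?thesis using assms by (simp add: internal_direct_sum_def)
qed

text \<open>Membership of a module in its own class turns equality of classes into an isomorphism.\<close>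
lemma mem_iso_class:
  assumes "module K M" "fg_module K M"
  shows "M \<in> iso_class K M"
proof -
  interpret module K M by fact
  have "(\<lambda>x \<in> carrier M. x) \<in> mod_hom K M M" by (simp add: mod_hom_def)
  moreover have "bij_betw (\<lambda>x \<in> carrier M. x) (carrier M) (carrier M)"
    by (simp add: bij_betw_def inj_on_def)
  ultimately show ?thesis using assms unfolding iso_class_def mod_iso_def by blast
qed

lemma mem_graded_iso_class:
  assumes gr: "qgraded R G M" and fg: "fg_module R M"
  shows "M \<in> graded_iso_class R G M"
proof -
  interpret module R M using gr by (simp add: qgraded_def)
  have sub: "homog M \<alpha> \<subseteq> carrier M" for \<alpha>
    using gr additive_subgroup.a_subset unfolding qgraded_def internal_direct_sum_def by blast
  have "(\<lambda>x \<in> carrier M. x) \<in> mod_hom R M (qshift 0 M)"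
    by (simp add: mod_hom_def qshift_def)
  moreover have "bij_betw (\<lambda>x \<in> carrier M. x) (carrier M) (carrier (qshift 0 M))"
    by (simp add: bij_betw_def inj_on_def qshift_def)
  moreover have "(\<lambda>x \<in> carrier M. x) ` homog M \<alpha> \<subseteq> homog (qshift 0 M) \<alpha>" for \<alpha>
    using sub[of \<alpha>] by (auto simp: qshift_def)
  ultimately have "graded_iso R M (qshift 0 M)" unfolding graded_iso_def by blast
  then show ?thesis using assms unfolding graded_iso_class_def by blast
qed

context prime_char_ring begin

text \<open>Say that a summand \<open>M e i\<close> factors through \<open>\<^sup>fR\<close> if its projection does.  It factors through
\<open>\<^sup>eR\<close>; if it factors through \<open>\<^sup>fR\<close>, then also through \<open>\<^bsup>f'\<^esup>R\<close> for \<open>f' \<ge> f\<close>, since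
\<open>\<^sup>fR\<close> is a direct summand of \<open>\<^bsup>f'\<^esup>R\<close> by the Frobenius splitting; and the property depends on the
isomorphism class alone.  So choosing one summand in each of the finitely many classes and taking \<open>f\<close>
at least as large as all their levels makes every summand of every \<open>\<^sup>eR\<close> factor through \<open>\<^sup>fR\<close>.  The
labels \<open>\<kappa>\<close> abstract from what an isomorphism class is, to cover the graded and ungraded case.\<close>
lemma generating_level_exists:
  fixes n :: "nat \<Rightarrow> nat" and M :: "nat \<Rightarrow> nat \<Rightarrow> 'a set" and \<kappa> :: "nat \<Rightarrow> nat \<Rightarrow> 'c"
  assumes \<pi>: "\<pi> \<in> Hom 1 0" "\<pi> \<one> = \<one>"
    and ds: "\<And>e. internal_direct_sum R {..<n e} (M e)"
    and stable: "\<And>e i r x. i < n e \<Longrightarrow> r \<in> carrier R \<Longrightarrow> x \<in> M e i \<Longrightarrow> r [^] (p ^ e) \<otimes> x \<in> M e i"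
    and fin: "finite {\<kappa> e i | e i. i < n e}"
    and iso: "\<And>e i e' i'. i < n e \<Longrightarrow> i' < n e' \<Longrightarrow> \<kappa> e i = \<kappa> e' i' \<Longrightarrow>
      \<exists>h. bij_betw h (M e i) (M e' i') \<and> (\<forall>x \<in> M e i. \<forall>y \<in> M e i. h (x \<oplus> y) = h x \<oplus> h y) \<and>
        (\<forall>r \<in> carrier R. \<forall>x \<in> M e i. h (r [^] (p ^ e) \<otimes> x) = r [^] (p ^ e') \<otimes> h x)"
  shows "\<exists>f. generating_level f"
proof -
  define pr where "pr e i = (\<lambda>x \<in> carrier R. component {..<n e} (M e) x i)" for e i
  have MR: "M e i \<subseteq> carrier R" if "i < n e" for e i using summand_subset[OF ds] that by simp
  have Madd: "x \<oplus> y \<in> M e i" if "i < n e" "x \<in> M e i" "y \<in> M e i" for e i x y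
    using additive_subgroup.a_closed[OF summand_subgroup[OF ds]] that by simp
  have pr_mem: "pr e i x \<in> M e i" if "i < n e" "x \<in> carrier R" for e i x
    using component_mem[OF ds that(2)] that by (simp add: pr_def)
  have pr_id: "pr e i x = x" if "i < n e" "x \<in> M e i" for e i x
    using component_of_summand[OF ds _ that(2), of i] that MR by (auto simp: pr_def)
  have pr_Hom: "pr e i \<in> Hom e e" if i: "i < n e" for e i
    unfolding pr_def
  proof (rule HomI)
    fix x y assume x: "x \<in> carrier R" and y: "y \<in> carrier R"
    show "component {..<n e} (M e) x i \<in> carrier R" using component_closed[OF ds x] i by simp
    show "component {..<n e} (M e) (x \<oplus> y) i =
        component {..<n e} (M e) x i \<oplus> component {..<n e} (M e) y i"
      using component_add[OF ds x y] i by simp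
  next
    fix r x assume r: "r \<in> carrier R" and x: "x \<in> carrier R"
    show "component {..<n e} (M e) (r [^] p ^ e \<otimes> x) i =
        r [^] p ^ e \<otimes> component {..<n e} (M e) x i"
      by (rule component_additive[OF ds x]) (use i r stable in \<open>auto simp: r_distr\<close>)
  qed
  define factors where "factors f e i \<longleftrightarrow>
    (\<exists>\<alpha> \<in> Hom e f. \<exists>\<beta> \<in> Hom f e. \<forall>x \<in> carrier R. \<beta> (\<alpha> x) = pr e i x)" for f e i
  have factors_self: "factors e e i" if "i < n e" for e i
    unfolding factors_def
    by (intro bexI[OF _ id_Hom] bexI[OF _ pr_Hom[OF that]]) simp
  have factors_mono: "factors f' e i" if "factors f e i" "f \<le> f'" for f f' e i
  proof -
    obtain \<alpha> \<beta> where \<alpha>: "\<alpha> \<in> Hom e f" and \<beta>: "\<beta> \<in> Hom f e"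
      and eq: "\<And>x. x \<in> carrier R \<Longrightarrow> \<beta> (\<alpha> x) = pr e i x"
      using \<open>factors f e i\<close> unfolding factors_def by blast
    define k where "k = f' - f"
    then have f': "f' = f + k" using \<open>f \<le> f'\<close> by simp
    obtain \<rho> where \<rho>: "\<rho> \<in> Hom k 0" and \<rho>_pow: "\<And>x. x \<in> carrier R \<Longrightarrow> \<rho> (x [^] (p ^ k)) = x"
      using iterated_splitting[OF \<pi>, of k] by metis
    have "\<rho> \<in> Hom f' f" using Hom_shift[OF \<rho>, of f] by (simp add: f' add.commute)
    then have "\<beta> \<star> \<rho> \<in> Hom f' e" using \<beta> by (rule Hom_compose)
    moreover have "Frob k \<star> \<alpha> \<in> Hom e f'" unfolding f' by (rule Hom_compose[OF \<alpha> Frob_Hom])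
    moreover have "(\<beta> \<star> \<rho>) ((Frob k \<star> \<alpha>) x) = pr e i x" if "x \<in> carrier R" for x
      using that eq by (simp add: compose_apply Frob_def Hom_closed[OF \<alpha>] \<rho>_pow)
    ultimately show ?thesis unfolding factors_def by blast
  qed
  have factors_iso: "factors f e' i'"
    if fac: "factors f e i" and i: "i < n e" and i': "i' < n e'" and \<kappa>: "\<kappa> e i = \<kappa> e' i'" for f e i e' i'
  proof -
    obtain \<alpha> \<beta> where \<alpha>: "\<alpha> \<in> Hom e f" and \<beta>: "\<beta> \<in> Hom f e"
      and eq: "\<And>x. x \<in> carrier R \<Longrightarrow> \<beta> (\<alpha> x) = pr e i x"
      using fac unfolding factors_def by blast
    obtain h where bij: "bij_betw h (M e i) (M e' i')"
      and hadd: "\<And>x y. x \<in> M e i \<Longrightarrow> y \<in> M e i \<Longrightarrow> h (x \<oplus> y) = h x \<oplus> h y"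
      and hsm: "\<And>r x. r \<in> carrier R \<Longrightarrow> x \<in> M e i \<Longrightarrow> h (r [^] (p ^ e) \<otimes> x) = r [^] (p ^ e') \<otimes> h x"
      using iso[OF i i' \<kappa>] by blast
    define g where "g = inv_into (M e i) h"
    have hM: "h x \<in> M e' i'" if "x \<in> M e i" for x using bij_betwE[OF bij] that by blast
    have gM: "g y \<in> M e i" and hg: "h (g y) = y" if "y \<in> M e' i'" for y
      using that bij_betwE[OF bij_betw_inv_into[OF bij]] bij_betw_inv_into_right[OF bij]
      by (auto simp: g_def)
    have gh: "g (h x) = x" if "x \<in> M e i" for x
      using bij_betw_inv_into_left[OF bij that] by (simp add: g_def)
    have gadd: "g (y \<oplus> z) = g y \<oplus> g z" if "y \<in> M e' i'" "z \<in> M e' i'" for y z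
    proof -
      have "g (h (g y \<oplus> g z)) = g y \<oplus> g z" by (rule gh) (intro Madd i gM that)
      then show ?thesis using hadd[of "g y" "g z"] that by (simp add: gM hg)
    qed
    have gsm: "g (r [^] (p ^ e') \<otimes> y) = r [^] (p ^ e) \<otimes> g y" if "r \<in> carrier R" "y \<in> M e' i'" for r y
    proof -
      have "g (h (r [^] (p ^ e) \<otimes> g y)) = r [^] (p ^ e) \<otimes> g y" by (rule gh) (intro stable i gM that)
      then show ?thesis using hsm[of r "g y"] that by (simp add: gM hg)
    qed
    have u: "(\<lambda>x \<in> carrier R. h (pr e i x)) \<in> Hom e e'"
    proof (rule HomI)
      fix x y assume "x \<in> carrier R" "y \<in> carrier R"
      then show "h (pr e i (x \<oplus> y)) = h (pr e i x) \<oplus> h (pr e i y)"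
        using i by (simp add: Hom_add[OF pr_Hom] hadd pr_mem)
      show "h (pr e i x) \<in> carrier R" using hM[OF pr_mem[OF i \<open>x \<in> carrier R\<close>]] MR[OF i'] by blast
    next
      fix r x assume "r \<in> carrier R" "x \<in> carrier R"
      then show "h (pr e i (r [^] p ^ e \<otimes> x)) = r [^] p ^ e' \<otimes> h (pr e i x)"
        using i by (simp add: Hom_smult[OF pr_Hom] hsm pr_mem)
    qed
    have v: "(\<lambda>x \<in> carrier R. g (pr e' i' x)) \<in> Hom e' e"
    proof (rule HomI)
      fix x y assume "x \<in> carrier R" "y \<in> carrier R"
      then show "g (pr e' i' (x \<oplus> y)) = g (pr e' i' x) \<oplus> g (pr e' i' y)"
        using i' by (simp add: Hom_add[OF pr_Hom] gadd pr_mem)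
      show "g (pr e' i' x) \<in> carrier R" using gM[OF pr_mem[OF i' \<open>x \<in> carrier R\<close>]] MR[OF i] by blast
    next
      fix r x assume "r \<in> carrier R" "x \<in> carrier R"
      then show "g (pr e' i' (r [^] p ^ e' \<otimes> x)) = r [^] p ^ e \<otimes> g (pr e' i' x)"
        using i' by (simp add: Hom_smult[OF pr_Hom] gsm pr_mem)
    qed
    let ?u = "\<lambda>x \<in> carrier R. h (pr e i x)" and ?v = "\<lambda>x \<in> carrier R. g (pr e' i' x)"
    have "(?u \<star> \<beta>) ((\<alpha> \<star> ?v) x) = pr e' i' x" if x: "x \<in> carrier R" for x
    proof -
      let ?y = "g (pr e' i' x)"
      have y: "?y \<in> M e i" using gM[OF pr_mem[OF i' x]] .
      then have yR: "?y \<in> carrier R" using MR[OF i] by blast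
      have "(?u \<star> \<beta>) ((\<alpha> \<star> ?v) x) = h (pr e i (\<beta> (\<alpha> ?y)))"
        using x yR by (simp add: compose_apply Hom_closed[OF \<alpha>] Hom_closed[OF \<beta>])
      also have "\<dots> = h ?y" using eq[OF yR] pr_id[OF i y] by simp
      also have "\<dots> = pr e' i' x" by (rule hg[OF pr_mem[OF i' x]])
      finally show ?thesis .
    qed
    then show ?thesis
      unfolding factors_def using Hom_compose[OF v \<alpha>] Hom_compose[OF \<beta> u] by blast
  qed
  let ?K = "{\<kappa> e i | e i. i < n e}"
  have "\<forall>c \<in> ?K. \<exists>e. \<exists>i < n e. \<kappa> e i = c" by blast
  then obtain lev where lev: "\<forall>c \<in> ?K. \<exists>i < n (lev c). \<kappa> (lev c) i = c"
    using bchoice[of ?K "\<lambda>c e. \<exists>i < n e. \<kappa> e i = c"] by blast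
  \<comment> \<open>any common upper bound of the levels would do\<close>
  define f where "f = sum lev ?K"
  have fac: "factors f e i" if i: "i < n e" for e i
  proof -
    have c: "\<kappa> e i \<in> ?K" using i by blast
    then obtain i0 where i0: "i0 < n (lev (\<kappa> e i))" "\<kappa> (lev (\<kappa> e i)) i0 = \<kappa> e i" using lev by blast
    have "lev (\<kappa> e i) \<le> f" unfolding f_def by (rule member_le_sum[OF c _ fin]) simp
    then have "factors f (lev (\<kappa> e i)) i0" by (rule factors_mono[OF factors_self[OF i0(1)]])
    then show ?thesis by (rule factors_iso[OF _ i0(1) i i0(2)])
  qed
  have "generating_level f"
    unfolding generating_level_def
  proof
    fix e
    have "\<forall>i \<in> {..<n e}. \<exists>\<alpha>\<beta>. fst \<alpha>\<beta> \<in> Hom e f \<and> snd \<alpha>\<beta> \<in> Hom f e \<and>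
      (\<forall>x \<in> carrier R. snd \<alpha>\<beta> (fst \<alpha>\<beta> x) = pr e i x)"
    proof
      fix i assume "i \<in> {..<n e}"
      then obtain \<alpha> \<beta> where "\<alpha> \<in> Hom e f" "\<beta> \<in> Hom f e" "\<forall>x \<in> carrier R. \<beta> (\<alpha> x) = pr e i x"
        using fac unfolding factors_def by blast
      then show "\<exists>\<alpha>\<beta>. fst \<alpha>\<beta> \<in> Hom e f \<and> snd \<alpha>\<beta> \<in> Hom f e \<and>
          (\<forall>x \<in> carrier R. snd \<alpha>\<beta> (fst \<alpha>\<beta> x) = pr e i x)"
        by (intro exI[of _ "(\<alpha>, \<beta>)"]) simp
    qed
    from bchoice[OF this] obtain w where w: "\<forall>i \<in> {..<n e}. fst (w i) \<in> Hom e f \<and>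
      snd (w i) \<in> Hom f e \<and> (\<forall>x \<in> carrier R. snd (w i) (fst (w i) x) = pr e i x)" ..
    have "(\<Oplus>i \<in> {..<n e}. snd (w i) (fst (w i) x)) = x" if x: "x \<in> carrier R" for x
    proof -
      have "(\<Oplus>i \<in> {..<n e}. snd (w i) (fst (w i) x)) =
          (\<Oplus>i \<in> {..<n e}. component {..<n e} (M e) x i)"
        by (rule finsum_cong') (use w x component_closed[OF ds x] in \<open>auto simp: pr_def\<close>)
      also have "\<dots> = x" by (rule component_sum[OF ds x]) auto
      finally show ?thesis .
    qed
    then show "\<exists>(k :: nat) \<alpha> \<beta>. (\<forall>i < k. \<alpha> i \<in> Hom e f \<and> \<beta> i \<in> Hom f e) \<and>
        (\<forall>x \<in> carrier R. (\<Oplus>i \<in> {..<k}. \<beta> i (\<alpha> i x)) = x)"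
      using w by (intro exI[of _ "n e"] exI[of _ "\<lambda>i. fst (w i)"] exI[of _ "\<lambda>i. snd (w i)"]) auto
  qed
  then show ?thesis ..
qed

lemma frobenius_module_simps:
  "carrier (frobenius_module p e R) = carrier R"
  "add (frobenius_module p e R) = add R"
  "ring.zero (frobenius_module p e R) = \<zero>"
  "smult (frobenius_module p e R) = (\<lambda>r x. r [^] (p ^ e) \<otimes> x)"
  by (simp_all add: frobenius_module_def with_action_def)

lemma graded_frobenius_module_simps:
  "carrier (graded_frobenius_module p e R G) = carrier R"
  "add (graded_frobenius_module p e R G) = add R"
  "ring.zero (graded_frobenius_module p e R G) = \<zero>"
  "smult (graded_frobenius_module p e R G) = (\<lambda>r x. r [^] (p ^ e) \<otimes> x)"
  by (simp_all add: graded_frobenius_module_def module.extend_def frobenius_module_simps)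

lemma FFRT_generating_level:
  assumes \<pi>: "\<pi> \<in> Hom 1 0" "\<pi> \<one> = \<one>" and ffrt: "FFRT p R"
  shows "\<exists>f. generating_level f"
proof -
  let ?F = "\<lambda>e. frobenius_module p e R"
  obtain n :: "nat \<Rightarrow> nat" and M where
    NM: "\<forall>e. internal_direct_sum (?F e) {..<n e} (M e) \<and>
       (\<forall>i < n e. submodule (M e i) R (?F e) \<and> indecomposable_module R ((?F e)\<lparr>carrier := M e i\<rparr>))"
    and fin: "finite {iso_class R ((?F e)\<lparr>carrier := M e i\<rparr>) | e i. i < n e}"
    using ffrt unfolding FFRT_def by (elim exE conjE)
  show ?thesis
  proof (rule generating_level_exists[OF \<pi> _ _ fin])
    show "internal_direct_sum R {..<n e} (M e)" for e
      using NM internal_direct_sum_cong[of "?F e" R "{..<n e}" "M e"] by (simp add: frobenius_module_simps)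
    show "r [^] (p ^ e) \<otimes> x \<in> M e i" if "i < n e" "r \<in> carrier R" "x \<in> M e i" for e i r x
    proof -
      have "submodule (M e i) R (?F e)" using NM that by blast
      from submodule.smult_closed[OF this that(2,3)] show ?thesis by (simp add: frobenius_module_simps)
    qed
    fix e i e' i' assume i: "i < n e" and i': "i' < n e'"
      and eq: "iso_class R ((?F e)\<lparr>carrier := M e i\<rparr>) = iso_class R ((?F e')\<lparr>carrier := M e' i'\<rparr>)"
    have "indecomposable_module R ((?F e)\<lparr>carrier := M e i\<rparr>)" using NM i by blast
    then have "(?F e)\<lparr>carrier := M e i\<rparr> \<in> iso_class R ((?F e)\<lparr>carrier := M e i\<rparr>)"
      unfolding indecomposable_module_def by (intro mem_iso_class) blast+
    then have "mod_iso R ((?F e)\<lparr>carrier := M e i\<rparr>) ((?F e')\<lparr>carrier := M e' i'\<rparr>)"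
      unfolding eq unfolding iso_class_def by blast
    then show "\<exists>h. bij_betw h (M e i) (M e' i') \<and> (\<forall>x \<in> M e i. \<forall>y \<in> M e i. h (x \<oplus> y) = h x \<oplus> h y) \<and>
        (\<forall>r \<in> carrier R. \<forall>x \<in> M e i. h (r [^] (p ^ e) \<otimes> x) = r [^] (p ^ e') \<otimes> h x)"
      by (auto simp: mod_iso_def mod_hom_def frobenius_module_simps)
  qed
qed

text \<open>A degree-preserving isomorphism onto a shifted module is in particular an isomorphism, so the
grading can be forgotten.\<close>
lemma graded_FFRT_generating_level:
  assumes \<pi>: "\<pi> \<in> Hom 1 0" "\<pi> \<one> = \<one>" and ffrt: "graded_FFRT p R G"
  shows "\<exists>f. generating_level f"
proof -
  let ?F = "\<lambda>e. graded_frobenius_module p e R G"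
  obtain n :: "nat \<Rightarrow> nat" and M where
    NM: "\<forall>e. internal_direct_sum (?F e) {..<n e} (M e) \<and>
       (\<forall>i < n e. graded_submodule (M e i) R G (?F e) \<and>
          graded_indecomposable R G (qrestrict (?F e) (M e i)))"
    and fin: "finite {graded_iso_class R G (qrestrict (?F e) (M e i)) | e i. i < n e}"
    using ffrt unfolding graded_FFRT_def by (elim exE conjE)
  show ?thesis
  proof (rule generating_level_exists[OF \<pi> _ _ fin])
    show "internal_direct_sum R {..<n e} (M e)" for e
      using NM internal_direct_sum_cong[of "?F e" R "{..<n e}" "M e"] by (simp add: graded_frobenius_module_simps)
    show "r [^] (p ^ e) \<otimes> x \<in> M e i" if "i < n e" "r \<in> carrier R" "x \<in> M e i" for e i r x
    proof -
      have "submodule (M e i) R (?F e)" using NM that unfolding graded_submodule_def by blast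
      from submodule.smult_closed[OF this that(2,3)] show ?thesis
        by (simp add: graded_frobenius_module_simps)
    qed
    fix e i e' i' assume i: "i < n e" and i': "i' < n e'"
      and eq: "graded_iso_class R G (qrestrict (?F e) (M e i)) =
        graded_iso_class R G (qrestrict (?F e') (M e' i'))"
    have "graded_indecomposable R G (qrestrict (?F e) (M e i))" using NM i by blast
    then have "qrestrict (?F e) (M e i) \<in> graded_iso_class R G (qrestrict (?F e) (M e i))"
      unfolding graded_indecomposable_def by (intro mem_graded_iso_class) blast+
    then obtain \<alpha> where "graded_iso R (qrestrict (?F e) (M e i)) (qshift \<alpha> (qrestrict (?F e') (M e' i')))"
      unfolding eq unfolding graded_iso_class_def by blast
    then show "\<exists>h. bij_betw h (M e i) (M e' i') \<and> (\<forall>x \<in> M e i. \<forall>y \<in> M e i. h (x \<oplus> y) = h x \<oplus> h y) \<and>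
        (\<forall>r \<in> carrier R. \<forall>x \<in> M e i. h (r [^] (p ^ e) \<otimes> x) = r [^] (p ^ e') \<otimes> h x)"
      by (auto simp: graded_iso_def mod_hom_def qrestrict_def qshift_def graded_frobenius_module_simps)
  qed
qed

end

section \<open>Simplicity\<close>

theorem theorem4p2p1:
  fixes R :: "('a, 'b) ring_scheme" and p :: nat
  assumes "cring R" and "noetherian_ring R"
    and "Factorial_Ring.prime p" and "has_char R p"
    and "(complete_local_type p R \<and> FFRT p R) \<or>
         (\<exists>G :: nat \<Rightarrow> 'a set. graded_type p R G \<and> graded_FFRT p R G)"
    and "strongly_F_regular p R"
  shows "simple_ring (diff_ops_int R)"
proof -
  interpret prime_char_ring R p
    using assms(1,3,4) by (intro prime_char_ring.intro prime_char_ring_axioms.intro)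
  note noeth = assms(2) and sfr = assms(6)
  have idem: "e = \<zero>\<^bsub>R\<^esub> \<or> e = \<one>\<^bsub>R\<^esub>" if "e \<in> carrier R" "e \<otimes>\<^bsub>R\<^esub> e = e" for e
    using assms(5)
  proof (elim disjE exE conjE)
    assume "complete_local_type p R"
    then obtain m where "unique_maximal_ideal m R" unfolding complete_local_type_def by blast
    then show ?thesis using local_idempotent[OF noeth] that by blast
  next
    fix G assume "graded_type p R G"
    then have "graded_ring R G" "subfield (G 0) R" by (simp_all add: graded_type_def)
    then show ?thesis using graded_idempotent that by blast
  qed
  have dom: "domain R" by (rule strongly_F_regular_domain[OF sfr noeth idem])
  obtain \<pi> where \<pi>: "\<pi> \<in> Hom 1 0" "\<pi> \<one>\<^bsub>R\<^esub> = \<one>\<^bsub>R\<^esub>"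
    using strongly_F_regular_F_split[OF sfr noeth dom] by blast
  obtain f where f: "generating_level f"
    using assms(5) FFRT_generating_level[OF \<pi>] graded_FFRT_generating_level[OF \<pi>] by blast
  have gens: "\<exists>U. finite U \<and> frob_generates e U" for e by (rule F_finite_generators[OF sfr])
  have functional: "\<exists>d. \<exists>\<phi> \<in> Hom d 0. \<phi> c = \<one>\<^bsub>R\<^esub>" if c: "c \<in> carrier R" "c \<noteq> \<zero>\<^bsub>R\<^esub>" for c
  proof -
    have "y = \<zero>\<^bsub>R\<^esub>" if "y \<in> carrier R" "c \<otimes>\<^bsub>R\<^esub> y = \<zero>\<^bsub>R\<^esub>" for y
      using domain.integral[OF dom that(2) c(1) that(1)] c(2) by blast
    then obtain d \<phi> where "\<phi> \<in> Hom d 0" "\<phi> c = \<one>\<^bsub>R\<^esub>"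
      by (rule strongly_F_regular_functional[OF sfr noeth c(1)])
    then show ?thesis by blast
  qed
  have "\<one>\<^bsub>diff_ops_int R\<^esub> \<one>\<^bsub>R\<^esub> \<noteq> \<zero>\<^bsub>diff_ops_int R\<^esub> \<one>\<^bsub>R\<^esub>"
    using one_neq_zero by (simp add: diff_ops_int_simps)
  then have "\<one>\<^bsub>diff_ops_int R\<^esub> \<noteq> \<zero>\<^bsub>diff_ops_int R\<^esub>" by metis
  moreover have "I = {\<zero>\<^bsub>diff_ops_int R\<^esub>} \<or> I = carrier (diff_ops_int R)"
    if "ideal I (diff_ops_int R)" for I
    using ideal_diff_ops_trivial[OF gens functional \<pi> f that] diff_ops_int_simps(3) by metis
  ultimately show ?thesis
    using ring_diff_ops_int[OF gens] unfolding simple_ring_def by blast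
qed

end
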